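(* Fix $k\in\mathbb{N}$ and consider the Erdős–Rényi hypergraph $\mathcal{H}(n,\bm{r},\bm{p})$ with hyperedge sizes $r_i=r_i(n)$ and connection probabilities $p_i=p_i(n)$, $1\le i\le k$. Assume that $\sigma^2>0$ and that the limits $$w_i:=\lim_{n\to\infty}\frac{\binom{n-2}{r_i-2}\sigma_i^2}{\sum_{j=1}^k\binom{n-2}{r_j-2}\sigma_j^2},\qquad 1\le i\le k,$$ exist. Let $\bm{X}=(X_1,\dots,X_M)$ be the vector of centered hyperedge indicators of the hypergraph, and let $\bm{Z}=(Z_1,\dots,Z_M)$ be a vector of independent Gaussian random variables with $Z_l\sim\mathcal{N}(0,\sigma_i^2)$ whenever $e_l$ is an $r_i$-edge (i.e. $M_{i-1}<l\le M_i$). Let $r_{\max}:=\max\{r_i:1\le i\le k\}$, $\xi:=\sum_{i=1}^k w_i\frac1{r_i^2}$, $d_i:=\binom{n-1}{r_i-1}p_i$, and $$K_n:=\frac{\sqrt{n\sigma^2}}{r_{\max}^6\,\xi}.$$ Say that $\bm{Y}=(Y_1,\dots,Y_M)$ satisfies the Pastur-type condition if, for every $\epsilon>0$, $$\sum_{l=1}^M\mathbb{E}\left[Y_l^2\,\mathbf{1}(|Y_l|>\epsilon K_n)\right]=o\left(\frac{n^2\sigma^2}{r_{\max}^4}\right)\qquad\text{as } n\to\infty.$$ (i) If both $\bm{X}$ and $\bm{Z}$ satisfy the Pastur-type condition, then $\bm{X}$ is $\bm{Z}$-Gaussianizable, that is, $$\lim_{n\to\infty}\left|S_{\bar\mu_{H_n(\bm{X})}}(z)-S_{\bar\mu_{H_n(\bm{Z})}}(z)\right|=0\qquad\text{for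 every } z\in\mathbb{C}_+ .$$ (ii) Assume that $1-p_i=\Theta(1)$ for $1\le i\le k$ and that $$\frac{\left(\sum_{i=1}^k r_i d_i\right)^2}{r_{\max}^{16}\,\xi^2\,\sum_{i=1}^k\frac{d_i}{r_i}}\longrightarrow\infty\qquad(n\to\infty).$$ Then both $\bm{X}$ and $\bm{Z}$ satisfy the Pastur-type condition; consequently, $\bm{X}$ is $\bm{Z}$-Gaussianizable.
   Context: Model. $k\in\mathbb{N}$ is fixed, independent of $n$. For each $n$, $\bm{r}=(r_1,\dots,r_k)$ are integers with $2\le r_i\le n$ and $\bm{p}=(p_1,\dots,p_k)\in[0,1]^k$; both may depend on $n$. Let $V=\{1,\dots,n\}$, $M_0=0$, $M_i=\sum_{j=1}^i\binom{n}{r_j}$, $M=M_k$. Let $e_1,\dots,e_M$ be such that, for each $i$, $e_{M_{i-1}+1},\dots,e_{M_i}$ enumerate all subsets of $V$ of size $r_i$ (these are the potential $r_i$-edges). The random hypergraph $\mathcal{H}(n,\bm{r},\bm{p})$ includes the potential hyperedges independently, each $r_i$-edge with probability $p_i$: the indicators $h_1,\dots,h_M$ are independent and $h_l\sim\mathrm{Ber}(p_i)$ for $M_{i-1}<l\le M_i$. For each $l$, $Q_l$ is the $n\times n$ matrix with $(Q_l)_{uv}=1$ if $u\ne v$ and $u,v\in e_l$, and $(Q_l)_{uv}=0$ otherwise. The adjacency matrix is $A=\sum_{l=1}^M h_lQ_l$. Set $\sigma_i^2=p_i(1-p_i)$ and $\sigma^2=\sum_{i=1}^k\binom{n-2}{r_i-2}\sigma_i^2$.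 The vector $\bm{X}$ has components $X_l=h_l-\mathbb{E}[h_l]$, and $$H_n(\bm{x})=\frac{1}{\sqrt{n\sigma^2}}\sum_{l=1}^M x_lQ_l,\quad \bm{x}\in\mathbb{R}^M,\qquad\text{so that } H_n(\bm{X})=\frac{A-\mathbb{E}[A]}{\sqrt{n\sigma^2}}.$$ For a random real symmetric $n\times n$ matrix $B$ with eigenvalues $\lambda_1,\dots,\lambda_n$, $\mu_B=\frac1n\sum_{i=1}^n\delta_{\lambda_i}$ is its empirical spectral distribution, and $\bar\mu_B$ is the deterministic probability measure given by $\int f\,d\bar\mu_B=\mathbb{E}\left[\int f\,d\mu_B\right]$ for bounded continuous $f$. For a probability measure $\mu$ on $\mathbb{R}$, its Stieltjes transform is $S_\mu(z)=\int_{\mathbb{R}}\frac{1}{x-z}\,d\mu(x)$ for $z\in\mathbb{C}_+=\{z\in\mathbb{C}:\operatorname{Im}z>0\}$. $f(n)=\Theta(g(n))$ means $f=O(g)$ and $g=O(f)$ as $n\to\infty$; thus $1-p_i=\Theta(1)$ means that $1-p_i(n)$ is bounded below by a positive constant for all large $n$. *)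

theory Defs
  imports "HOL-Probability.Probability" "HOL-Library.Landau_Symbols"
    "Jordan_Normal_Form.Char_Poly"
begin

text \<open>
  For a fixed number of vertices \<open>n\<close>, the model parameters are \<open>k\<close>, \<open>r i\<close> and \<open>p i\<close> for
  \<open>i \<in> {1..k}\<close>; values outside this range are irrelevant. The vertex set is \<open>{1..n}\<close>, and
  \<open>e l\<close> is the potential hyperedge number \<open>l\<close>.
\<close>

definition num_edges :: "nat \<Rightarrow> (nat \<Rightarrow> nat) \<Rightarrow> nat \<Rightarrow> nat" where
  "num_edges n r i = (\<Sum>j=1..i. n choose r j)"

text \<open>The indices \<open>l\<close> with $M_{i-1} < l \le M_i$.\<close>

definition edge_block :: "nat \<Rightarrow> (nat \<Rightarrow> nat) \<Rightarrow> nat \<Rightarrow> nat set" where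
  "edge_block n r i = {num_edges n r (i - 1)<..num_edges n r i}"

definition edge_enumeration :: "nat \<Rightarrow> nat \<Rightarrow> (nat \<Rightarrow> nat) \<Rightarrow> (nat \<Rightarrow> nat set) \<Rightarrow> bool" where
  "edge_enumeration n k r e \<longleftrightarrow>
     (\<forall>i\<in>{1..k}. bij_betw e (edge_block n r i) {S. S \<subseteq> {1..n} \<and> card S = r i})"

definition sigma_sq_i :: "(nat \<Rightarrow> real) \<Rightarrow> nat \<Rightarrow> real" where
  "sigma_sq_i p i = p i * (1 - p i)"

definition sigma_sq :: "nat \<Rightarrow> nat \<Rightarrow> (nat \<Rightarrow> nat) \<Rightarrow> (nat \<Rightarrow> real) \<Rightarrow> real" where
  "sigma_sq n k r p = (\<Sum>i=1..k. real ((n - 2) choose (r i - 2)) * sigma_sq_i p i)"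

definition r_max :: "nat \<Rightarrow> (nat \<Rightarrow> nat) \<Rightarrow> nat" where
  "r_max k r = Max (r ` {1..k})"

definition xi :: "nat \<Rightarrow> (nat \<Rightarrow> nat) \<Rightarrow> (nat \<Rightarrow> real) \<Rightarrow> real" where
  "xi k r w = (\<Sum>i=1..k. w i * (1 / (real (r i))^2))"

definition avg_degree :: "nat \<Rightarrow> (nat \<Rightarrow> nat) \<Rightarrow> (nat \<Rightarrow> real) \<Rightarrow> nat \<Rightarrow> real" where
  "avg_degree n r p i = real ((n - 1) choose (r i - 1)) * p i"

definition K_trunc ::
  "nat \<Rightarrow> nat \<Rightarrow> (nat \<Rightarrow> nat) \<Rightarrow> (nat \<Rightarrow> real) \<Rightarrow> (nat \<Rightarrow> real) \<Rightarrow> real" where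
  "K_trunc n k r p w = sqrt (real n * sigma_sq n k r p) / ((real (r_max k r))^6 * xi k r w)"

text \<open>Matrix indices start at 0, so row \<open>u\<close> belongs to vertex \<open>Suc u\<close>.\<close>

definition Q_mat :: "nat \<Rightarrow> nat set \<Rightarrow> real mat" where
  "Q_mat n S = Matrix.mat n n
     (\<lambda>(u, v). if u \<noteq> v \<and> Suc u \<in> S \<and> Suc v \<in> S then 1 else 0)"

definition H_mat ::
  "nat \<Rightarrow> nat \<Rightarrow> (nat \<Rightarrow> nat) \<Rightarrow> (nat \<Rightarrow> real) \<Rightarrow> (nat \<Rightarrow> nat set) \<Rightarrow> (nat \<Rightarrow> real) \<Rightarrow> real mat" where
  "H_mat n k r p e x = (1 / sqrt (real n * sigma_sq n k r p)) \<cdot>\<^sub>m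
     Matrix.mat n n (\<lambda>(u, v). \<Sum>l=1..num_edges n r k. x l * Q_mat n (e l) $$ (u, v))"

text \<open>
  The empirical spectral distribution of a real symmetric matrix of dimension at least 1: all
  roots of its characteristic polynomial are real, so \<open>proots\<close> is the full multiset of eigenvalues.
\<close>

definition esd :: "real mat \<Rightarrow> real measure" where
  "esd B = distr (measure_pmf (pmf_of_multiset (proots (char_poly B)))) borel (\<lambda>x. x)"

definition mean_esd :: "'a measure \<Rightarrow> ('a \<Rightarrow> real mat) \<Rightarrow> real measure" where
  "mean_esd P B = (THE \<mu>. real_distribution \<mu> \<and>
     (\<forall>f :: real \<Rightarrow> real. continuous_on UNIV f \<and> bounded (range f) \<longrightarrow>
        (\<integral>x. f x \<partial>\<mu>) = (\<integral>\<omega>. (\<integral>x. f x \<partial>esd (B \<omega>)) \<partial>P)))"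

definition stieltjes :: "real measure \<Rightarrow> complex \<Rightarrow> complex" where
  "stieltjes \<mu> z = (\<integral>x. 1 / (complex_of_real x - z) \<partial>\<mu>)"

definition bernoulli_law :: "real \<Rightarrow> real measure" where
  "bernoulli_law q = distr (measure_pmf (bernoulli_pmf q)) borel of_bool"

text \<open>
  Centered Gaussian law of variance \<open>v\<close>. The degenerate case is needed because some of the
  variances may vanish.
\<close>

definition gaussian_law :: "real \<Rightarrow> real measure" where
  "gaussian_law v =
     (if v = 0 then return borel 0 else density lborel (\<lambda>x. ennreal (normal_density 0 (sqrt v) x)))"

text \<open>\<open>Y 1, \<dots>, Y M\<close> are independent and \<open>Y l\<close> has law \<open>L i\<close> whenever \<open>e l\<close> is an \<open>r i\<close>-edge.\<close>

definition indep_edge_vector ::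
  "nat \<Rightarrow> nat \<Rightarrow> (nat \<Rightarrow> nat) \<Rightarrow> (nat \<Rightarrow> real measure) \<Rightarrow> 'a measure \<Rightarrow> (nat \<Rightarrow> 'a \<Rightarrow> real) \<Rightarrow> bool" where
  "indep_edge_vector n k r L P Y \<longleftrightarrow>
     prob_space P \<and>
     prob_space.indep_vars P (\<lambda>_. borel) Y {1..num_edges n r k} \<and>
     (\<forall>i\<in>{1..k}. \<forall>l\<in>edge_block n r i. distr P borel (Y l) = L i)"

definition centered :: "'a measure \<Rightarrow> (nat \<Rightarrow> 'a \<Rightarrow> real) \<Rightarrow> nat \<Rightarrow> 'a \<Rightarrow> real" where
  "centered P h l \<omega> = h l \<omega> - (\<integral>\<omega>'. h l \<omega>' \<partial>P)"

text \<open>From here on, all parameters except \<open>k\<close> and \<open>w\<close> are sequences indexed by \<open>n\<close>.\<close>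

definition pastur_condition ::
  "nat \<Rightarrow> (nat \<Rightarrow> nat \<Rightarrow> nat) \<Rightarrow> (nat \<Rightarrow> nat \<Rightarrow> real) \<Rightarrow> (nat \<Rightarrow> real) \<Rightarrow>
   (nat \<Rightarrow> 'a measure) \<Rightarrow> (nat \<Rightarrow> nat \<Rightarrow> 'a \<Rightarrow> real) \<Rightarrow> bool" where
  "pastur_condition k r p w P Y \<longleftrightarrow>
     (\<forall>\<epsilon>>0.
        (\<lambda>n. \<Sum>l=1..num_edges n (r n) k.
           \<integral>\<omega>. (Y n l \<omega>)^2 * indicator {\<omega>'. \<bar>Y n l \<omega>'\<bar> > \<epsilon> * K_trunc n k (r n) (p n) w} \<omega> \<partial>P n)
        \<in> o(\<lambda>n. (real n)^2 * sigma_sq n k (r n) (p n) / (real (r_max k (r n)))^4))"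

definition gaussianizable ::
  "nat \<Rightarrow> (nat \<Rightarrow> nat \<Rightarrow> nat) \<Rightarrow> (nat \<Rightarrow> nat \<Rightarrow> real) \<Rightarrow> (nat \<Rightarrow> nat \<Rightarrow> nat set) \<Rightarrow>
   (nat \<Rightarrow> 'a measure) \<Rightarrow> (nat \<Rightarrow> nat \<Rightarrow> 'a \<Rightarrow> real) \<Rightarrow>
   (nat \<Rightarrow> 'b measure) \<Rightarrow> (nat \<Rightarrow> nat \<Rightarrow> 'b \<Rightarrow> real) \<Rightarrow> bool" where
  "gaussianizable k r p e P X P' Z \<longleftrightarrow>
     (\<forall>z. Im z > 0 \<longrightarrow>
        (\<lambda>n. cmod
           (stieltjes (mean_esd (P n) (\<lambda>\<omega>. H_mat n k (r n) (p n) (e n) (\<lambda>l. X n l \<omega>))) z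
          - stieltjes (mean_esd (P' n) (\<lambda>\<omega>. H_mat n k (r n) (p n) (e n) (\<lambda>l. Z n l \<omega>))) z))
        \<longlonglongrightarrow> 0)"

end

theory Submission
  imports Defs "Jordan_Normal_Form.Schur_Decomposition"
begin

text \<open>
  Fix $z$ with positive imaginary part and write $F(x) = \frac1n \mathrm{tr}(H_n(x) - z)^{-1}$. The
  Stieltjes transform of the mean empirical spectral distribution of $H_n(Y)$ at $z$ is
  $\mathbb{E} F(Y)$ (\<open>stieltjes_mean_esd\<close>), so the theorem compares $\mathbb{E} F(X)$ with
  $\mathbb{E} F(Z)$, where the independent entries of $X$ and $Z$ share their first two moments.

  The comparison is Lindeberg's: the entries of $X$ are exchanged for those of $Z$ one at a time
  (\<open>lindeberg_replacement\<close>). As a function of a single coordinate $t$, $F$ is a quadratic polynomial,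
  whose expectation does not change in the exchange, plus a remainder. For a hyperedge of size $r$,
  and with $\tau = \sqrt{n\sigma^2}$, the remainder is at most a constant (depending on $z$) times
  $\frac1n \min(r^4 t^2/\tau^2,\; r^6 |t|^3/\tau^3)$. The expansion is algebraic: it is obtained by
  iterating the second resolvent identity $R' = R - t R Q R'$, where $Q$ is the matrix of the hyperedge,
  and its last term is a sum of at most $r^4$ (or $r^6$) products of entries of $R$ and $R'R$, which are bounded because
  $\mathrm{Im}(z)\,|x| \le |(B - z)x|$ for symmetric $B$ (\<open>resolvent_trace_taylor\<close>).

  The quadratic bound is used where $|t| > T$ and the cubic one, in the form $|t|^3 \le T t^2$, where
  $|t| \le T$, with $T = \epsilon K_n$. The first part, summed over hyperedges, is what the
  Pastur-type condition controls. In the second part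
  the absorption identity $r(r-1)\binom nr = n(n-1)\binom{n-2}{r-2}$ turns the sum of the weighted
  variances into at most $2 n^2 r_{\max}^4 \sigma^2$. The limits $w_i$ are nonnegative and add up to
  one, so $1 \le r_{\max}^2 \xi$, and the definition of $K_n$ leaves a bound of order $\epsilon$
  (\<open>swap_error_sum\<close>). This proves the first claim.

  For the second claim both vectors satisfy $\mathbb{E} Y_l^4 \le 3 p_i$, hence
  $\mathbb{E}[Y_l^2; |Y_l| > T] \le 3 p_i / T^2$. Summing with $r \binom nr = n \binom{n-1}{r-1}$ gives
  $3 n T^{-2} \sum_i d_i / r_i$, while $1 - p_i \ge c$ gives $n \sigma^2 \ge \frac c2 \sum_i r_i d_i$;
  up to constants, the ratio assumed to diverge compares the squared lower bound with the upper bound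
  (\<open>truncated_variance_small\<close>).

  The mean spectral distribution is a definite description, so that its existence has to be proved,
  and this rests on the measurability of $\omega \mapsto \int f\,d\mu_{B(\omega)}$. Power sums of
  the eigenvalues are traces of powers of the matrix, and every continuous function is a pointwise limit
  of polynomials, so that measurability passes from power sums to all functions that matter.
\<close>

section \<open>Resolvents of real symmetric matrices\<close>

lemma index_mult_mat_sum:
  assumes "A \<in> carrier_mat n m" "B \<in> carrier_mat m q" "i < n" "j < q"
  shows "(A * B) $$ (i, j) = (\<Sum>k<m. A $$ (i, k) * B $$ (k, j))"
  using assms by (auto simp: times_mat_def scalar_prod_def atLeast0LessThan intro!: sum.cong)

definition mtrace :: "'a::comm_monoid_add mat \<Rightarrow> 'a" where
  "mtrace A = (\<Sum>i<dim_row A. A $$ (i, i))"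

lemma mtrace_mult_comm:
  fixes A B :: "'a::comm_semiring_0 mat"
  assumes "A \<in> carrier_mat n m" "B \<in> carrier_mat m n"
  shows "mtrace (A * B) = mtrace (B * A)"
proof -
  have "mtrace (A * B) = (\<Sum>i<n. \<Sum>k<m. A $$ (i, k) * B $$ (k, i))"
    using assms by (auto simp: mtrace_def index_mult_mat_sum[OF assms] simp del: index_mult_mat(1) intro!: sum.cong)
  also have "\<dots> = (\<Sum>k<m. \<Sum>i<n. B $$ (k, i) * A $$ (i, k))"
    by (subst sum.swap) (simp add: mult.commute)
  also have "\<dots> = mtrace (B * A)"
    using assms by (auto simp: mtrace_def index_mult_mat_sum[OF assms(2,1)] simp del: index_mult_mat(1) intro!: sum.cong)
  finally show ?thesis .
qed

lemma mtrace_add: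
  assumes "A \<in> carrier_mat n n" "B \<in> carrier_mat n n"
  shows "mtrace (A + B) = mtrace A + mtrace B"
  using assms by (auto simp: mtrace_def sum.distrib)

lemma mtrace_smult:
  fixes A :: "'a::comm_semiring_0 mat"
  assumes "A \<in> carrier_mat n n"
  shows "mtrace (c \<cdot>\<^sub>m A) = c * mtrace A"
  using assms by (auto simp: mtrace_def sum_distrib_left)

definition real_symmetric :: "nat \<Rightarrow> real mat \<Rightarrow> bool" where
  "real_symmetric n B \<longleftrightarrow> B \<in> carrier_mat n n \<and> (\<forall>i<n. \<forall>j<n. B $$ (i, j) = B $$ (j, i))"

abbreviation shifted :: "real mat \<Rightarrow> complex \<Rightarrow> complex mat" where
  "shifted B z \<equiv> char_matrix (map_mat complex_of_real B) z"

lemma shifted_carrier [simp]: "B \<in> carrier_mat n n \<Longrightarrow> shifted B z \<in> carrier_mat n n"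
  by simp

lemma index_shifted:
  assumes "B \<in> carrier_mat n n" "i < n" "j < n"
  shows "shifted B z $$ (i, j) = complex_of_real (B $$ (i, j)) - (if i = j then z else 0)"
  using assms by (auto simp: char_matrix_def)

abbreviation cnorm :: "nat \<Rightarrow> (nat \<Rightarrow> complex) \<Rightarrow> real" where
  "cnorm n x \<equiv> L2_set (\<lambda>i. cmod (x i)) {..<n}"

text \<open>
  The quadratic form of a real symmetric matrix is real, so the imaginary part of
  $\langle x, (B - z) x\rangle$ is $-\mathrm{Im}(z)\,|x|^2$; Cauchy--Schwarz does the rest. This one
  estimate provides the invertibility of $B - z$, the reality of the eigenvalues of $B$ and all bounds
  on resolvents.
\<close>
lemma shifted_expands:
  assumes B: "real_symmetric n B"
  shows "\<bar>Im z\<bar> * cnorm n x \<le> cnorm n (\<lambda>i. \<Sum>j<n. shifted B z $$ (i, j) * x j)"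
    (is "_ \<le> cnorm n ?y")
proof -
  let ?b = "\<lambda>i j. complex_of_real (B $$ (i, j))"
  have Bc: "B \<in> carrier_mat n n" and sym: "\<And>i j. i < n \<Longrightarrow> j < n \<Longrightarrow> B $$ (i, j) = B $$ (j, i)"
    using B by (auto simp: real_symmetric_def)
  define q where "q = (\<Sum>i<n. \<Sum>j<n. cnj (x i) * ?b i j * x j)"
  have "cnj q = (\<Sum>i<n. \<Sum>j<n. x i * ?b i j * cnj (x j))"
    unfolding q_def by (simp only: cnj_sum complex_cnj_mult complex_cnj_cnj complex_cnj_complex_of_real)
  also have "\<dots> = (\<Sum>j<n. \<Sum>i<n. x i * ?b i j * cnj (x j))"
    by (rule sum.swap)
  also have "\<dots> = q"
    unfolding q_def by (intro sum.cong refl) (auto simp: sym)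
  finally have q: "Im q = 0"
    by (metis Reals_cnj_iff complex_is_Real_iff)
  have y: "?y i = (\<Sum>j<n. ?b i j * x j) - z * x i" if "i < n" for i
  proof -
    have "?y i = (\<Sum>j<n. ?b i j * x j - (if i = j then z * x j else 0))"
      using that by (intro sum.cong refl) (auto simp: index_shifted[OF Bc] algebra_simps)
    then show ?thesis using that by (simp add: sum_subtractf sum.delta)
  qed
  have "(\<Sum>i<n. cnj (x i) * ?y i) = (\<Sum>i<n. cnj (x i) * ((\<Sum>j<n. ?b i j * x j) - z * x i))"
    by (intro sum.cong refl) (simp only: y lessThan_iff)
  also have "\<dots> = q - z * (\<Sum>i<n. cnj (x i) * x i)"
    unfolding q_def
    by (simp only: sum_subtractf[symmetric] sum_distrib_left right_diff_distrib mult.assoc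
        mult.left_commute[of "cnj _" z])
  also have "(\<Sum>i<n. cnj (x i) * x i) = complex_of_real ((cnorm n x)\<^sup>2)"
    by (simp add: L2_set_def real_sqrt_pow2 sum_nonneg complex_norm_square mult.commute del: of_real_power)
  finally have "Im (\<Sum>i<n. cnj (x i) * ?y i) = - Im z * (cnorm n x)\<^sup>2"
    using q by simp
  then have "\<bar>Im z\<bar> * (cnorm n x)\<^sup>2 \<le> cmod (\<Sum>i<n. cnj (x i) * ?y i)"
    using abs_Im_le_cmod[of "\<Sum>i<n. cnj (x i) * ?y i"] by (simp add: abs_mult)
  also have "\<dots> \<le> (\<Sum>i<n. \<bar>cmod (x i)\<bar> * \<bar>cmod (?y i)\<bar>)"
    by (rule order_trans[OF norm_sum]) (simp add: norm_mult)
  also have "\<dots> \<le> cnorm n x * cnorm n ?y"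
    by (rule L2_set_mult_ineq)
  finally have "cnorm n x * (\<bar>Im z\<bar> * cnorm n x) \<le> cnorm n x * cnorm n ?y"
    by (simp add: power2_eq_square mult_ac)
  then show ?thesis
    using L2_set_nonneg[of "\<lambda>i. cmod (x i)" "{..<n}"] L2_set_nonneg[of "\<lambda>i. cmod (?y i)" "{..<n}"]
    by (cases "cnorm n x = 0") auto
qed

lemma det_shifted_nonzero:
  assumes B: "real_symmetric n B" and z: "Im z \<noteq> 0"
  shows "Determinant.det (shifted B z) \<noteq> 0"
proof
  assume d: "Determinant.det (shifted B z) = 0"
  have Bc: "B \<in> carrier_mat n n" using B by (auto simp: real_symmetric_def)
  then have C: "shifted B z \<in> carrier_mat n n" by simp
  obtain v where v: "v \<in> carrier_vec n" "v \<noteq> 0\<^sub>v n" "shifted B z *\<^sub>v v = 0\<^sub>v n"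
    using det_0_iff_vec_prod_zero_field[OF C] d by auto
  have "(\<Sum>j<n. shifted B z $$ (i, j) * vec_index v j) = 0" if "i < n" for i
  proof -
    have "(\<Sum>j<n. shifted B z $$ (i, j) * vec_index v j) = vec_index (shifted B z *\<^sub>v v) i"
      using that C v(1) by (auto simp: scalar_prod_def atLeast0LessThan intro!: sum.cong)
    then show ?thesis using v that by simp
  qed
  then have "cnorm n (\<lambda>i. \<Sum>j<n. shifted B z $$ (i, j) * vec_index v j) = 0"
    by (simp add: L2_set_def)
  then have "\<bar>Im z\<bar> * cnorm n (vec_index v) \<le> 0"
    using shifted_expands[OF B, where z = z and x = "vec_index v"] by (simp only:)
  then have "cnorm n (vec_index v) = 0"
    using z L2_set_nonneg[of "\<lambda>i. cmod (vec_index v i)" "{..<n}"]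
    by (simp add: mult_le_0_iff)
  then have "vec_index v i = 0" if "i < n" for i
    using that by (simp add: L2_set_eq_0_iff)
  then have "v = 0\<^sub>v n" using v(1) by auto
  then show False using v(2) by simp
qed

text \<open>
  The inverse of $B - z$, written with the adjugate so that it is a total function.
\<close>
definition resolvent :: "real mat \<Rightarrow> complex \<Rightarrow> complex mat" where
  "resolvent B z = inverse (Determinant.det (shifted B z)) \<cdot>\<^sub>m adj_mat (shifted B z)"

lemma resolvent_carrier [simp]:
  assumes "B \<in> carrier_mat n n" shows "resolvent B z \<in> carrier_mat n n"
  using adj_mat(1)[OF shifted_carrier[OF assms]] by (simp add: resolvent_def)

lemma resolvent_inverse:
  assumes B: "real_symmetric n B" and z: "Im z \<noteq> 0"
  shows "shifted B z * resolvent B z = 1\<^sub>m n" "resolvent B z * shifted B z = 1\<^sub>m n"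
proof -
  have "B \<in> carrier_mat n n" using B by (auto simp: real_symmetric_def)
  then have C: "shifted B z \<in> carrier_mat n n" by simp
  note adj = adj_mat[OF C] and d = det_shifted_nonzero[OF B z]
  show "shifted B z * resolvent B z = 1\<^sub>m n"
    unfolding resolvent_def mult_smult_distrib[OF C adj(1)] adj(2)
    using d by (intro eq_matI) auto
  show "resolvent B z * shifted B z = 1\<^sub>m n"
    unfolding resolvent_def mult_smult_assoc_mat[OF adj(1) C] adj(3)
    using d by (intro eq_matI) auto
qed

text \<open>
  Column by column, multiplication by a resolvent contracts the Euclidean norm by the factor
  $1/\mathrm{Im}(z)$. Entries of products of resolvents are bounded through the norms of their columns.
\<close>
lemma column_norm_resolvent_mult:
  assumes B: "real_symmetric n B" and z: "Im z > 0" and A: "A \<in> carrier_mat n n" and j: "j < n"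
  shows "cnorm n (\<lambda>i. (resolvent B z * A) $$ (i, j)) \<le> cnorm n (\<lambda>i. A $$ (i, j)) / Im z"
proof -
  have Bc: "B \<in> carrier_mat n n" using B by (auto simp: real_symmetric_def)
  note C = shifted_carrier[OF Bc, of z] and R = resolvent_carrier[OF Bc, of z]
  have eq: "shifted B z * (resolvent B z * A) = A"
    using resolvent_inverse(1)[OF B, of z] z C R A
    by (simp flip: assoc_mult_mat[OF C R A])
  have "(\<Sum>k<n. shifted B z $$ (i, k) * (resolvent B z * A) $$ (k, j)) = A $$ (i, j)" if "i < n" for i
    using index_mult_mat_sum[OF C mult_carrier_mat[OF R A] that j] eq by simp
  then have "cnorm n (\<lambda>i. \<Sum>k<n. shifted B z $$ (i, k) * (resolvent B z * A) $$ (k, j))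
      = cnorm n (\<lambda>i. A $$ (i, j))"
    by (intro L2_set_cong refl) simp
  then show ?thesis
    using shifted_expands[OF B, where z = z and x = "\<lambda>i. (resolvent B z * A) $$ (i, j)"] z
    by (simp add: field_simps)
qed

lemma resolvent_bounds:
  assumes B: "real_symmetric n B" and B': "real_symmetric n B'" and z: "Im z > 0"
    and ij: "i < n" "j < n"
  shows "cmod (resolvent B z $$ (i, j)) \<le> 1 / Im z"
    and "cmod ((resolvent B' z * resolvent B z) $$ (i, j)) \<le> 1 / (Im z)\<^sup>2"
proof -
  have Bc: "B \<in> carrier_mat n n" using B by (auto simp: real_symmetric_def)
  note R = resolvent_carrier[OF Bc, of z]
  have "cnorm n (\<lambda>i. (1\<^sub>m n :: complex mat) $$ (i, j)) = L2_set (\<lambda>i. if i = j then 1 else 0) {..<n}"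
    using ij by (intro L2_set_cong refl) auto
  also have "\<dots> = 1" using ij by (simp add: L2_set_def if_distrib[of "\<lambda>x. x\<^sup>2"] sum.delta cong: if_cong)
  finally have one: "cnorm n (\<lambda>i. (1\<^sub>m n :: complex mat) $$ (i, j)) = 1" .
  have c1: "cnorm n (\<lambda>i. resolvent B z $$ (i, j)) \<le> 1 / Im z"
    using column_norm_resolvent_mult[OF B z one_carrier_mat ij(2)] one R by simp
  have "cnorm n (\<lambda>i. (resolvent B' z * resolvent B z) $$ (i, j))
      \<le> cnorm n (\<lambda>i. resolvent B z $$ (i, j)) / Im z"
    by (rule column_norm_resolvent_mult[OF B' z R ij(2)])
  also have "\<dots> \<le> 1 / Im z / Im z"
    using c1 z by (intro divide_right_mono) auto
  finally have c2: "cnorm n (\<lambda>i. (resolvent B' z * resolvent B z) $$ (i, j)) \<le> 1 / (Im z)\<^sup>2"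
    by (simp add: power2_eq_square)
  show "cmod (resolvent B z $$ (i, j)) \<le> 1 / Im z"
    using member_le_L2_set[of "{..<n}" i "\<lambda>i. cmod (resolvent B z $$ (i, j))"] ij c1 by simp
  show "cmod ((resolvent B' z * resolvent B z) $$ (i, j)) \<le> 1 / (Im z)\<^sup>2"
    using member_le_L2_set[of "{..<n}" i "\<lambda>i. cmod ((resolvent B' z * resolvent B z) $$ (i, j))"] ij c2
    by simp
qed

section \<open>Taylor expansion of the resolvent trace\<close>

text \<open>
  The perturbations are small in the sense that their nonzero entries, at most one in absolute value,
  lie in a block \<open>S \<times> S\<close>. Only this block enters the estimates, so that they do not depend on
  the dimension.
\<close>
definition supported_on :: "nat \<Rightarrow> nat set \<Rightarrow> real mat \<Rightarrow> bool" where
  "supported_on n S Q \<longleftrightarrow> real_symmetric n Q \<and> S \<subseteq> {..<n} \<and>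
     (\<forall>i<n. \<forall>j<n. \<bar>Q $$ (i, j)\<bar> \<le> of_bool (i \<in> S \<and> j \<in> S))"

abbreviation cmat :: "real mat \<Rightarrow> complex mat" where
  "cmat \<equiv> map_mat complex_of_real"

lemma supported_sum_bound:
  assumes Q: "supported_on n S Q" and a: "\<And>i j. i < n \<Longrightarrow> j < n \<Longrightarrow> cmod (f i j) \<le> a"
  shows "cmod (\<Sum>i<n. \<Sum>j<n. f i j * cmat Q $$ (i, j)) \<le> real (card S) ^ 2 * a"
proof -
  have S: "S \<subseteq> {..<n}" and Qc: "Q \<in> carrier_mat n n"
    and Qb: "\<And>i j. i < n \<Longrightarrow> j < n \<Longrightarrow> \<bar>Q $$ (i, j)\<bar> \<le> of_bool (i \<in> S \<and> j \<in> S)"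
    using Q by (auto simp: supported_on_def real_symmetric_def)
  have "cmod (\<Sum>i<n. \<Sum>j<n. f i j * cmat Q $$ (i, j))
      \<le> (\<Sum>i<n. \<Sum>j<n. cmod (f i j) * \<bar>Q $$ (i, j)\<bar>)"
    using Qc by (intro order_trans[OF norm_sum] sum_mono) (auto simp: norm_mult)
  also have "\<dots> \<le> (\<Sum>i<n. \<Sum>j<n. a * (of_bool (i \<in> S) * of_bool (j \<in> S)))"
  proof (intro sum_mono)
    fix i j assume ij: "i \<in> {..<n}" "j \<in> {..<n}"
    have "0 \<le> a" using a[of i j] ij by (auto intro: order_trans[OF norm_ge_zero])
    then show "cmod (f i j) * \<bar>Q $$ (i, j)\<bar> \<le> a * (of_bool (i \<in> S) * of_bool (j \<in> S))"
      using ij Qb[of i j] a[of i j] by (intro mult_mono) auto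
  qed
  also have "\<dots> = a * ((\<Sum>i<n. of_bool (i \<in> S)) * (\<Sum>j<n. of_bool (j \<in> S)))"
    unfolding sum_product by (simp only: sum_distrib_left)
  also have "(\<Sum>i<n. of_bool (i \<in> S)) = real (card S)"
    using S by (simp add: of_bool_def sum.If_cases Int_absorb1)
  finally show ?thesis by (simp add: power2_eq_square mult_ac)
qed

lemma index_sandwich_bound:
  assumes Q: "supported_on n S Q" and C: "A \<in> carrier_mat n n" "C \<in> carrier_mat n n"
    and A: "\<And>i j. i < n \<Longrightarrow> j < n \<Longrightarrow> cmod (A $$ (i, j)) \<le> a"
    and B: "\<And>i j. i < n \<Longrightarrow> j < n \<Longrightarrow> cmod (C $$ (i, j)) \<le> c"
    and ij: "i < n" "j < n"
  shows "cmod ((A * cmat Q * C) $$ (i, j)) \<le> real (card S) ^ 2 * (a * c)"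
proof -
  have Qc: "cmat Q \<in> carrier_mat n n"
    using Q by (auto simp: supported_on_def real_symmetric_def)
  have "(A * cmat Q * C) $$ (i, j) = (\<Sum>l<n. \<Sum>k<n. A $$ (i, k) * cmat Q $$ (k, l) * C $$ (l, j))"
    using ij by (simp add: index_mult_mat_sum[OF mult_carrier_mat[OF C(1) Qc] C(2)]
        index_mult_mat_sum[OF C(1) Qc] sum_distrib_right del: index_mult_mat(1) index_map_mat)
  also have "\<dots> = (\<Sum>k<n. \<Sum>l<n. (A $$ (i, k) * C $$ (l, j)) * cmat Q $$ (k, l))"
    by (subst sum.swap) (simp only: mult_ac)
  also have "cmod \<dots> \<le> real (card S) ^ 2 * (a * c)"
  proof (rule supported_sum_bound[OF Q])
    fix k l assume "k < n" "l < n"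
    then show "cmod (A $$ (i, k) * C $$ (l, j)) \<le> a * c"
      using A[of i k] B[of l j] ij unfolding norm_mult
      by (intro mult_mono) (auto intro: order_trans[OF norm_ge_zero])
  qed
  finally show ?thesis .
qed

lemma mtrace_supported_bound:
  assumes Q: "supported_on n S Q" and C: "A \<in> carrier_mat n n"
    and A: "\<And>i j. i < n \<Longrightarrow> j < n \<Longrightarrow> cmod (A $$ (i, j)) \<le> a"
  shows "cmod (mtrace (A * cmat Q)) \<le> real (card S) ^ 2 * a"
proof -
  have Qc: "cmat Q \<in> carrier_mat n n"
    using Q by (auto simp: supported_on_def real_symmetric_def)
  have "mtrace (A * cmat Q) = (\<Sum>i<n. \<Sum>k<n. A $$ (i, k) * cmat Q $$ (k, i))"
    using C Qc by (auto simp: mtrace_def index_mult_mat_sum[OF C Qc] simp del: index_mult_mat(1) index_map_mat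
       intro!: sum.cong)
  also have "\<dots> = (\<Sum>k<n. \<Sum>i<n. A $$ (i, k) * cmat Q $$ (k, i))" by (rule sum.swap)
  also have "cmod \<dots> \<le> real (card S) ^ 2 * a"
    by (rule supported_sum_bound[OF Q]) (rule A)
  finally show ?thesis .
qed

lemma real_symmetric_add_smult:
  "real_symmetric n B \<Longrightarrow> real_symmetric n Q \<Longrightarrow> real_symmetric n (B + t \<cdot>\<^sub>m Q)"
  unfolding real_symmetric_def by auto

text \<open>
  The second resolvent identity: multiply $(B + tQ - z) - (B - z) = tQ$ by the two resolvents.
\<close>
lemma resolvent_identity:
  fixes t :: real
  assumes B: "real_symmetric n B" and Q: "real_symmetric n Q" and z: "Im z > 0"
  defines "R \<equiv> resolvent B z" and "R' \<equiv> resolvent (B + t \<cdot>\<^sub>m Q) z"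
  shows "R = R' + complex_of_real t \<cdot>\<^sub>m (R * cmat Q * R')"
proof -
  let ?T = "complex_of_real t"
  have B': "real_symmetric n (B + t \<cdot>\<^sub>m Q)" by (rule real_symmetric_add_smult[OF B Q])
  have Bc: "B \<in> carrier_mat n n" and B'c: "B + t \<cdot>\<^sub>m Q \<in> carrier_mat n n"
    and Qc: "cmat Q \<in> carrier_mat n n" and Qr: "Q \<in> carrier_mat n n"
    using B B' Q by (auto simp: real_symmetric_def)
  have R: "R \<in> carrier_mat n n" and R': "R' \<in> carrier_mat n n"
    unfolding R_def R'_def using Bc B'c by auto
  note C = shifted_carrier[OF Bc, of z] and C' = shifted_carrier[OF B'c, of z]
  have z0: "Im z \<noteq> 0" using z by simp
  have inv: "R * shifted B z = 1\<^sub>m n" "shifted (B + t \<cdot>\<^sub>m Q) z * R' = 1\<^sub>m n"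
    unfolding R_def R'_def by (rule resolvent_inverse[OF B z0] resolvent_inverse[OF B' z0])+
  have TQ: "?T \<cdot>\<^sub>m cmat Q \<in> carrier_mat n n" using Qc by simp
  have sh: "shifted (B + t \<cdot>\<^sub>m Q) z = shifted B z + ?T \<cdot>\<^sub>m cmat Q"
    using Bc Qr by (intro eq_matI) (auto simp: char_matrix_def)
  have "R = R * (shifted (B + t \<cdot>\<^sub>m Q) z * R')"
    using inv(2) R by simp
  also have "\<dots> = (R * shifted (B + t \<cdot>\<^sub>m Q) z) * R'"
    by (rule assoc_mult_mat[OF R C' R', symmetric])
  also have "\<dots> = (1\<^sub>m n + R * (?T \<cdot>\<^sub>m cmat Q)) * R'"
    unfolding sh mult_add_distrib_mat[OF R C TQ] inv(1) ..
  also have "\<dots> = R' + R * (?T \<cdot>\<^sub>m cmat Q) * R'"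
    by (subst add_mult_distrib_mat[OF one_carrier_mat mult_carrier_mat[OF R TQ] R']) (use R' in simp)
  also have "R * (?T \<cdot>\<^sub>m cmat Q) * R' = ?T \<cdot>\<^sub>m (R * cmat Q * R')"
    unfolding mult_smult_distrib[OF R Qc] mult_smult_assoc_mat[OF mult_carrier_mat[OF R Qc] R'] ..
  finally show ?thesis .
qed

text \<open>
  With $G = RQ$ and $R'$ the perturbed resolvent, the resolvent identity reads $R = R' + t G R'$.
  Iterating it two and three times under the trace leaves the remainders
  $t^2 (\mathrm{tr}(G^2 R') - \mathrm{tr}(G^2 R))$ and $-t^3\, \mathrm{tr}(G^3 R')$ for the same quadratic
  polynomial. By cyclicity $R'$ is moved to the front and paired with the first $R$; the remaining factors
  are peeled off one block of \<open>Q\<close> at a time.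
\<close>
proposition resolvent_trace_taylor:
  assumes B: "real_symmetric n B" and Q: "supported_on n S Q" and z: "Im z > 0"
  shows "\<exists>a b. \<forall>t. cmod (mtrace (resolvent (B + t \<cdot>\<^sub>m Q) z)
             - (mtrace (resolvent B z) + complex_of_real t * a + (complex_of_real t)\<^sup>2 * b))
           \<le> min (2 * real (card S) ^ 4 / Im z ^ 3 * t\<^sup>2) (real (card S) ^ 6 / Im z ^ 4 * \<bar>t\<bar> ^ 3)"
proof -
  let ?s = "real (card S)"
  define R where "R = resolvent B z"
  define G where "G = R * cmat Q"
  have Qs: "real_symmetric n Q" using Q by (simp add: supported_on_def)
  have Bc: "B \<in> carrier_mat n n" and Qc: "cmat Q \<in> carrier_mat n n"
    using B Qs by (auto simp: real_symmetric_def)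
  have R: "R \<in> carrier_mat n n" unfolding R_def using Bc by simp
  have G: "G \<in> carrier_mat n n" unfolding G_def using R Qc by simp
  have GG: "G * G \<in> carrier_mat n n" and GGG: "G * G * G \<in> carrier_mat n n" using G by auto
  have Rb: "cmod (R $$ (i, j)) \<le> 1 / Im z" if "i < n" "j < n" for i j
    unfolding R_def by (rule resolvent_bounds(1)[OF B B z that])
  \<comment> \<open>Stated for the resolvent of any symmetric matrix: it is applied to the perturbed one and to \<open>R\<close> itself.\<close>
  have bounds: "cmod (mtrace (G * G * R')) \<le> ?s ^ 4 / Im z ^ 3 \<and>
      cmod (mtrace (G * G * G * R')) \<le> ?s ^ 6 / Im z ^ 4"
    if B': "real_symmetric n B'" and R'_def: "R' = resolvent B' z" for B' R'
  proof -
    have R': "R' \<in> carrier_mat n n" unfolding R'_def using B' by (simp add: real_symmetric_def)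
    have RR: "R' * R \<in> carrier_mat n n" using R R' by simp
    define W where "W = R' * R * cmat Q * R"
    define W' where "W' = W * cmat Q * R"
    have W: "W \<in> carrier_mat n n" unfolding W_def by (intro mult_carrier_mat[of _ n n] R' R Qc)
    have W': "W' \<in> carrier_mat n n" unfolding W'_def by (intro mult_carrier_mat[of _ n n] W R Qc)
    have Wb: "cmod (W $$ (i, j)) \<le> ?s ^ 2 * (1 / (Im z)\<^sup>2 * (1 / Im z))" if "i < n" "j < n" for i j
      unfolding W_def
      by (rule index_sandwich_bound[OF Q RR R _ Rb that])
         (auto simp: R_def R'_def intro: resolvent_bounds(2)[OF B B' z])
    have W'b: "cmod (W' $$ (i, j)) \<le> ?s ^ 2 * (?s ^ 2 * (1 / (Im z)\<^sup>2 * (1 / Im z)) * (1 / Im z))"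
      if "i < n" "j < n" for i j
      unfolding W'_def by (rule index_sandwich_bound[OF Q W R Wb Rb that])
    have RG: "R' * G \<in> carrier_mat n n" using R' G by simp
    have RGe: "R' * G = R' * R * cmat Q" unfolding G_def by (rule assoc_mult_mat[OF R' R Qc, symmetric])
    have WG: "R' * (G * G) = W * cmat Q"
    proof -
      have "R' * (G * G) = R' * G * G" by (rule assoc_mult_mat[OF R' G G, symmetric])
      also have "\<dots> = R' * G * R * cmat Q"
        unfolding G_def by (rule assoc_mult_mat[OF RG[unfolded G_def] R Qc, symmetric])
      finally show ?thesis unfolding W_def RGe .
    qed
    have WGG: "R' * (G * G * G) = W' * cmat Q"
    proof -
      have "R' * (G * G * G) = R' * (G * G) * G" by (rule assoc_mult_mat[OF R' GG G, symmetric])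
      also have "\<dots> = W * cmat Q * G" unfolding WG ..
      also have "\<dots> = W * cmat Q * R * cmat Q"
        unfolding G_def by (rule assoc_mult_mat[OF mult_carrier_mat[OF W Qc] R Qc, symmetric])
      finally show ?thesis unfolding W'_def .
    qed
    have "cmod (mtrace (G * G * R')) \<le> ?s ^ 2 * (?s ^ 2 * (1 / (Im z)\<^sup>2 * (1 / Im z)))"
      unfolding mtrace_mult_comm[OF GG R'] WG by (rule mtrace_supported_bound[OF Q W Wb])
    moreover have "cmod (mtrace (G * G * G * R'))
        \<le> ?s ^ 2 * (?s ^ 2 * (?s ^ 2 * (1 / (Im z)\<^sup>2 * (1 / Im z)) * (1 / Im z)))"
      unfolding mtrace_mult_comm[OF GGG R'] WGG by (rule mtrace_supported_bound[OF Q W' W'b])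
    moreover have "?s ^ 2 * (?s ^ 2 * (1 / (Im z)\<^sup>2 * (1 / Im z))) = ?s ^ 4 / Im z ^ 3"
      using z by (simp add: field_simps eval_nat_numeral)
    moreover have "?s ^ 2 * (?s ^ 2 * (?s ^ 2 * (1 / (Im z)\<^sup>2 * (1 / Im z)) * (1 / Im z)))
        = ?s ^ 6 / Im z ^ 4"
      using z by (simp add: field_simps eval_nat_numeral)
    ultimately show ?thesis by (simp only: simp_thms)
  qed
  define a where "a = - mtrace (G * R)"
  define b where "b = mtrace (G * G * R)"
  show ?thesis
  proof (intro exI allI)
    fix t :: real
    let ?T = "complex_of_real t"
    define R' where "R' = resolvent (B + t \<cdot>\<^sub>m Q) z"
    have B': "real_symmetric n (B + t \<cdot>\<^sub>m Q)" by (rule real_symmetric_add_smult[OF B Qs])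
    have R': "R' \<in> carrier_mat n n" unfolding R'_def using B' by (simp add: real_symmetric_def)
    have id: "R = R' + ?T \<cdot>\<^sub>m (G * R')"
      unfolding R_def R'_def G_def by (rule resolvent_identity[OF B Qs z])
    have step: "mtrace (A * R') = mtrace (A * R) - ?T * mtrace (A * G * R')"
      if A: "A \<in> carrier_mat n n" for A
    proof -
      have GR: "G * R' \<in> carrier_mat n n" using G R' by simp
      have "A * R = A * R' + A * (?T \<cdot>\<^sub>m (G * R'))"
        by (subst id) (rule mult_add_distrib_mat[OF A R'], use GR in simp)
      also have "A * (?T \<cdot>\<^sub>m (G * R')) = ?T \<cdot>\<^sub>m (A * G * R')"
        unfolding mult_smult_distrib[OF A GR] assoc_mult_mat[OF A G R'] ..
      finally have "mtrace (A * R) = mtrace (A * R') + mtrace (?T \<cdot>\<^sub>m (A * G * R'))"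
        using A G R' by (simp add: mtrace_add[of _ n])
      also have "mtrace (?T \<cdot>\<^sub>m (A * G * R')) = ?T * mtrace (A * G * R')"
        using A G R' by (intro mtrace_smult[of _ n]) simp
      finally show ?thesis by simp
    qed
    have s0: "mtrace R' = mtrace R - ?T * mtrace (G * R')"
      using step[of "1\<^sub>m n"] R R' G by simp
    note s1 = step[OF G] and s2 = step[OF GG]
    have e2: "mtrace R' - (mtrace R + ?T * a + ?T\<^sup>2 * b) = ?T\<^sup>2 * (mtrace (G * G * R') - mtrace (G * G * R))"
      unfolding s0 s1 a_def b_def by (simp add: algebra_simps power2_eq_square)
    have e3: "mtrace R' - (mtrace R + ?T * a + ?T\<^sup>2 * b) = - (?T ^ 3 * mtrace (G * G * G * R'))"
      unfolding e2 s2 by (simp add: algebra_simps power2_eq_square power3_eq_cube)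
    note b1 = bounds[OF B' R'_def] and b0 = bounds[OF B R_def]
    have "cmod (mtrace R' - (mtrace R + ?T * a + ?T\<^sup>2 * b)) \<le> t\<^sup>2 * (?s ^ 4 / Im z ^ 3 + ?s ^ 4 / Im z ^ 3)"
      unfolding e2 norm_mult using b1 b0
      by (intro mult_mono order_trans[OF norm_triangle_ineq4] add_mono) (auto simp: norm_power)
    moreover have "cmod (mtrace R' - (mtrace R + ?T * a + ?T\<^sup>2 * b)) \<le> \<bar>t\<bar> ^ 3 * (?s ^ 6 / Im z ^ 4)"
      unfolding e3 norm_minus_cancel norm_mult using b1 by (intro mult_mono) (auto simp: norm_power)
    ultimately show "cmod (mtrace (resolvent (B + t \<cdot>\<^sub>m Q) z) - (mtrace (resolvent B z) + ?T * a + ?T\<^sup>2 * b))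
           \<le> min (2 * ?s ^ 4 / Im z ^ 3 * t\<^sup>2) (?s ^ 6 / Im z ^ 4 * \<bar>t\<bar> ^ 3)"
      unfolding R_def[symmetric] R'_def[symmetric] by (simp add: mult_ac)
  qed
qed

section \<open>Eigenvalues, traces and the empirical spectral distribution\<close>

lemma logarithmic_derivative_prod_list:
  fixes z :: "'a::field"
  assumes "\<And>e. e \<in> set es \<Longrightarrow> e \<noteq> z"
  shows "(\<Sum>e\<leftarrow>es. 1 / (z - e)) * poly (\<Prod>e\<leftarrow>es. [:- e, 1:]) z
      = poly (pderiv (\<Prod>e\<leftarrow>es. [:- e, 1:])) z"
  using assms
proof (induction es)
  case (Cons e es)
  let ?S = "\<Sum>e\<leftarrow>es. 1 / (z - e)" and ?p = "\<Prod>e\<leftarrow>es. [:- e, 1:]"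
  have factor: "(1 / d + s) * (d * q) = q + d * (s * q)" if "d \<noteq> 0" for d s q :: 'a
    using that by (simp add: field_simps)
  have "z - e \<noteq> 0" using Cons.prems[of e] by auto
  then have "(1 / (z - e) + ?S) * ((z - e) * poly ?p z) = poly ?p z + (z - e) * (?S * poly ?p z)"
    by (rule factor)
  also have "?S * poly ?p z = poly (pderiv ?p) z"
    using Cons by simp
  also have "poly ?p z + (z - e) * poly (pderiv ?p) z
      = poly (pderiv (\<Prod>e\<leftarrow>e # es. [:- e, 1:])) z"
    by (simp only: list.map prod_list.Cons pderiv_mult poly_add poly_mult) (simp add: pderiv_pCons)
  finally have main: "(1 / (z - e) + ?S) * ((z - e) * poly ?p z)
      = poly (pderiv (\<Prod>e\<leftarrow>e # es. [:- e, 1:])) z" .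
  have "poly [:- e, 1:] z = z - e" by simp
  with main show ?case
    by (simp only: list.map prod_list.Cons sum_list.Cons poly_mult)
qed (simp add: pderiv_1)

lemma char_poly_shifted:
  assumes "A \<in> carrier_mat n n"
  shows "poly (char_poly A) z = (-1) ^ n * Determinant.det (char_matrix A z)"
proof -
  have "- char_matrix A z = (-1) \<cdot>\<^sub>m char_matrix A z" by auto
  then show ?thesis
    using char_poly_matrix[OF assms, of z] carrier_matD(2)[OF char_matrix_closed[OF assms, of z]] by simp
qed

lemma mat_delete_char_matrix:
  assumes "A \<in> carrier_mat n n" "i < n"
  shows "mat_delete (char_matrix A z) i i = char_matrix (mat_delete A i i) z"
  using assms by (intro eq_matI) (auto simp: mat_delete_def char_matrix_def)

text \<open>
  By Jacobi's formula the derivative of the characteristic polynomial is the sum of its principal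
  minors, which are the diagonal entries of the adjugate. Hence the trace of the resolvent is minus the
  logarithmic derivative of the characteristic polynomial.
\<close>
lemma mtrace_resolvent:
  assumes B: "real_symmetric n B" and z: "Im z \<noteq> 0"
  shows "mtrace (resolvent B z) * poly (char_poly (map_mat complex_of_real B)) z
      = - poly (pderiv (char_poly (map_mat complex_of_real B))) z"
proof -
  let ?A = "map_mat complex_of_real B"
  have Bc: "B \<in> carrier_mat n n" using B by (simp add: real_symmetric_def)
  then have A: "?A \<in> carrier_mat n n" by simp
  note d = det_shifted_nonzero[OF B z]
  have "mtrace (resolvent B z) * poly (char_poly ?A) z
      = (-1) ^ n * (\<Sum>i<n. Determinant.det (mat_delete (char_matrix ?A z) i i))"
    using Bc d
    by (simp add: mtrace_def resolvent_def adj_mat_def cofactor_def char_poly_shifted[OF A]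
        sum_distrib_left sum_distrib_right field_simps char_matrix_def)
  also have "\<dots> = - (\<Sum>i<n. poly (char_poly (mat_delete ?A i i)) z)"
  proof (cases n)
    case (Suc m)
    have "(-1) ^ n * Determinant.det (mat_delete (char_matrix ?A z) i i)
        = - poly (char_poly (mat_delete ?A i i)) z" if "i < n" for i
    proof -
      have "mat_delete ?A i i \<in> carrier_mat m m"
        using mat_delete_carrier[OF A, of i i] Suc by simp
      from char_poly_shifted[OF this, of z] show ?thesis
        by (simp add: Suc mat_delete_char_matrix[OF A that])
    qed
    then show ?thesis
      by (simp add: sum_distrib_left flip: sum_negf)
  qed simp
  also have "\<dots> = - poly (pderiv (char_poly ?A)) z"
    unfolding pderiv_char_poly[OF A] by (simp add: poly_sum)
  finally show ?thesis .
qed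

text \<open>
  The polynomial splits over the complex numbers, and its roots are real because $B - a$ is invertible
  for nonreal $a$.
\<close>
lemma real_symmetric_char_poly_splits:
  assumes B: "real_symmetric n B"
  shows "\<exists>es. length es = n \<and> char_poly B = (\<Prod>e\<leftarrow>es. [:- e, 1:])"
proof -
  let ?A = "map_mat complex_of_real B"
  have Bc: "B \<in> carrier_mat n n" using B by (simp add: real_symmetric_def)
  then have A: "?A \<in> carrier_mat n n" by simp
  obtain as where as: "char_poly ?A = (\<Prod>a\<leftarrow>as. [:- a, 1:])" "length as = n"
    using char_poly_factorized[OF A] by blast
  have "Im a = 0" if "a \<in> set as" for a
  proof (rule ccontr)
    assume "Im a \<noteq> 0"
    then have "poly (char_poly ?A) a \<noteq> 0"
      using det_shifted_nonzero[OF B] by (simp add: char_poly_shifted[OF A])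
    then show False
      using that unfolding as(1) poly_prod_list by (auto simp: prod_list_zero_iff o_def image_iff)
  qed
  then have re: "map complex_of_real (map Re as) = as"
    by (auto simp: o_def complex_eq_iff intro!: map_idI)
  interpret h: map_poly_inj_comm_ring_hom complex_of_real ..
  have "map_poly complex_of_real (char_poly B) = char_poly ?A"
    by (rule of_real_hom.char_poly_hom[OF Bc, symmetric])
  also have "\<dots> = (\<Prod>a\<leftarrow>map complex_of_real (map Re as). [:- a, 1:])" unfolding as(1) re ..
  also have "\<dots> = map_poly complex_of_real (\<Prod>e\<leftarrow>map Re as. [:- e, 1:])"
    by (simp only: h.hom_prod_list map_map o_def) simp
  finally have "char_poly B = (\<Prod>e\<leftarrow>map Re as. [:- e, 1:])" by simp
  with as(2) show ?thesis by (intro exI[of _ "map Re as"]) (simp only: length_map)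
qed

lemma upper_triangular_pow:
  fixes A :: "'a::comm_semiring_1 mat"
  assumes A: "A \<in> carrier_mat n n" and ut: "upper_triangular A" and i: "i < n"
  shows "(\<forall>j<i. (A ^\<^sub>m m) $$ (i, j) = 0) \<and> (A ^\<^sub>m m) $$ (i, i) = (A $$ (i, i)) ^ m"
proof (induction m)
  case 0
  then show ?case using A i by auto
next
  case (Suc m)
  have Am: "A ^\<^sub>m m \<in> carrier_mat n n" using A by simp
  have A0: "A $$ (k, j) = 0" if "j < k" "k < n" for j k
    using ut A that by auto
  have idx: "(A ^\<^sub>m Suc m) $$ (i, j) = (\<Sum>k<n. (A ^\<^sub>m m) $$ (i, k) * A $$ (k, j))" if "j < n" for j
    using index_mult_mat_sum[OF Am A i that] by simp
  have "(A ^\<^sub>m Suc m) $$ (i, j) = 0" if "j < i" for j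
    unfolding idx[OF less_trans[OF that i]]
  proof (intro sum.neutral ballI)
    fix k assume "k \<in> {..<n}"
    then show "(A ^\<^sub>m m) $$ (i, k) * A $$ (k, j) = 0"
      using Suc.IH A0[of j k] that by (cases "k < i") auto
  qed
  moreover have "(\<Sum>k<n. (A ^\<^sub>m m) $$ (i, k) * A $$ (k, i)) = (\<Sum>k<n. if k = i then (A $$ (i, i)) ^ Suc m else 0)"
  proof (intro sum.cong refl)
    fix k assume "k \<in> {..<n}"
    then show "(A ^\<^sub>m m) $$ (i, k) * A $$ (k, i) = (if k = i then (A $$ (i, i)) ^ Suc m else 0)"
      using Suc.IH A0[of i k] by (cases k i rule: linorder_cases) (auto simp: mult.commute)
  qed
  ultimately show ?case using idx[OF i] i by simp
qed

text \<open>
  The trace is invariant under similarity, and in a Schur form the diagonal of a power consists of the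
  powers of the eigenvalues.
\<close>
lemma mtrace_pow_eigenvalues:
  fixes B :: "real mat"
  assumes B: "B \<in> carrier_mat n n" and es: "char_poly B = (\<Prod>e\<leftarrow>es. [:- e, 1:])"
  shows "mtrace (B ^\<^sub>m m) = (\<Sum>e\<leftarrow>es. e ^ m)"
proof -
  obtain T P Q :: "real mat" where "schur_decomposition B es = (T, P, Q)"
    by (cases "schur_decomposition B es")
  then have sim: "similar_mat_wit B T P Q" and ut: "upper_triangular T" and diag: "diag_mat T = es"
    using schur_decomposition[OF B es] by auto
  have T: "T \<in> carrier_mat n n" by (rule similar_mat_witD2(5)[OF B sim])
  have P: "P \<in> carrier_mat n n" by (rule similar_mat_witD2(6)[OF B sim])
  have Q: "Q \<in> carrier_mat n n" by (rule similar_mat_witD2(7)[OF B sim])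
  have QP: "Q * P = 1\<^sub>m n" by (rule similar_mat_witD2(2)[OF B sim])
  have Tm: "T ^\<^sub>m m \<in> carrier_mat n n" using T by simp
  have "B ^\<^sub>m m \<in> carrier_mat n n" using B by simp
  from similar_mat_witD2(3)[OF this similar_mat_wit_pow[OF sim, of m]]
  have "mtrace (B ^\<^sub>m m) = mtrace (P * T ^\<^sub>m m * Q)" by simp
  also have "\<dots> = mtrace (Q * (P * T ^\<^sub>m m))"
    by (rule mtrace_mult_comm) (use P Q Tm in auto)
  also have "Q * (P * T ^\<^sub>m m) = T ^\<^sub>m m"
    unfolding assoc_mult_mat[OF Q P Tm, symmetric] QP by (rule left_mult_one_mat[OF Tm])
  also have "mtrace (T ^\<^sub>m m) = (\<Sum>i<n. (T $$ (i, i)) ^ m)"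
    using Tm T by (auto simp: mtrace_def upper_triangular_pow[OF T ut] intro!: sum.cong)
  also have "\<dots> = (\<Sum>e\<leftarrow>es. e ^ m)"
    using T by (simp add: diag[symmetric] diag_mat_def o_def atLeast0LessThan
       interv_sum_list_conv_sum_set_nat)
  finally show ?thesis .
qed

lemma mtrace_resolvent_eigenvalues:
  assumes B: "real_symmetric n B" and z: "Im z > 0" and es: "char_poly B = (\<Prod>e\<leftarrow>es. [:- e, 1:])"
  shows "(\<Sum>e\<leftarrow>es. 1 / (complex_of_real e - z)) = mtrace (resolvent B z)"
proof -
  let ?A = "map_mat complex_of_real B" and ?es = "map complex_of_real es"
  have Bc: "B \<in> carrier_mat n n" using B by (simp add: real_symmetric_def)
  then have A: "?A \<in> carrier_mat n n" by simp
  have z0: "Im z \<noteq> 0" using z by simp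
  interpret h: map_poly_inj_comm_ring_hom complex_of_real ..
  have cp: "char_poly ?A = (\<Prod>a\<leftarrow>?es. [:- a, 1:])"
    unfolding of_real_hom.char_poly_hom[OF Bc] es
    by (simp only: h.hom_prod_list map_map o_def) simp
  have nz: "poly (char_poly ?A) z \<noteq> 0"
    using det_shifted_nonzero[OF B z0] by (simp add: char_poly_shifted[OF A])
  have "a \<noteq> z" if "a \<in> set ?es" for a using that z by auto
  from logarithmic_derivative_prod_list[of ?es z, OF this]
  have ld: "(\<Sum>a\<leftarrow>?es. 1 / (z - a)) * poly (char_poly ?A) z = poly (pderiv (char_poly ?A)) z"
    unfolding cp .
  have "(\<Sum>a\<leftarrow>?es. 1 / (z - a)) = - (\<Sum>e\<leftarrow>es. 1 / (complex_of_real e - z))"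
    by (induction es) (auto simp: minus_divide_right)
  then have "(\<Sum>e\<leftarrow>es. 1 / (complex_of_real e - z)) * poly (char_poly ?A) z
      = - ((\<Sum>a\<leftarrow>?es. 1 / (z - a)) * poly (char_poly ?A) z)"
    by simp
  also have "\<dots> = mtrace (resolvent B z) * poly (char_poly ?A) z"
    unfolding ld mtrace_resolvent[OF B z0] ..
  finally have "(\<Sum>e\<leftarrow>es. 1 / (complex_of_real e - z)) * poly (char_poly ?A) z
      = mtrace (resolvent B z) * poly (char_poly ?A) z" .
  then show ?thesis using mult_right_cancel[OF nz] by blast
qed

lemma sum_list_eq_sum_count:
  fixes f :: "'a \<Rightarrow> 'b::real_vector"
  assumes "finite A" "set xs \<subseteq> A"
  shows "(\<Sum>x\<leftarrow>xs. f x) = (\<Sum>x\<in>A. real (count (mset xs) x) *\<^sub>R f x)"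
  using assms(2)
proof (induction xs)
  case (Cons y ys)
  have "(\<Sum>x\<in>A. real (count (mset (y # ys)) x) *\<^sub>R f x)
      = (\<Sum>x\<in>A. real (count (mset ys) x) *\<^sub>R f x + (if x = y then f y else 0))"
    by (intro sum.cong refl) (auto simp: scaleR_left_distrib)
  then show ?case using Cons assms(1) by (simp add: sum.distrib)
qed simp

lemma esd_integral:
  fixes f :: "real \<Rightarrow> 'b::{banach, second_countable_topology}"
  assumes es: "char_poly B = (\<Prod>e\<leftarrow>es. [:- e, 1:])" "es \<noteq> []" and f: "f \<in> borel_measurable borel"
  shows "(\<integral>x. f x \<partial>esd B) = (1 / real (length es)) *\<^sub>R (\<Sum>e\<leftarrow>es. f e)"
proof -
  have proots: "proots (char_poly B) = mset es"
  proof -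
    have "(\<Sum>e\<leftarrow>es. {#e#}) = mset es" by (induction es) auto
    moreover have "0 \<notin> set (map (\<lambda>e. [:- e, 1:]) es)" by auto
    ultimately show ?thesis
      using proots_prod_list[of "map (\<lambda>e. [:- e, 1:]) es"] by (simp add: es(1) o_def)
  qed
  have "(\<integral>x. f x \<partial>esd B) = (\<integral>x. f x \<partial>measure_pmf (pmf_of_multiset (mset es)))"
    unfolding esd_def proots using f by (subst integral_distr) auto
  also have "\<dots> = (\<Sum>x\<in>set es. pmf (pmf_of_multiset (mset es)) x *\<^sub>R f x)"
    using es(2) by (subst integral_measure_pmf[of "set es"]) auto
  also have "\<dots> = (1 / real (length es)) *\<^sub>R (\<Sum>e\<leftarrow>es. f e)"
    using es(2) by (simp add: sum_list_eq_sum_count[of "set es"] scaleR_sum_right)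
  finally show ?thesis .
qed

lemma esd_properties: "prob_space (esd B)" "sets (esd B) = sets borel" "space (esd B) = UNIV"
  unfolding esd_def by (auto intro!: measure_pmf.prob_space_distr)

section \<open>The mean empirical spectral distribution\<close>

text \<open>
  An enumeration of the eigenvalues with multiplicity, in an arbitrary order. Only symmetric functions of
  it are integrated or shown to be measurable.
\<close>
definition eigenvalues :: "real mat \<Rightarrow> real list" where
  "eigenvalues B = (SOME es. length es = dim_row B \<and> char_poly B = (\<Prod>e\<leftarrow>es. [:- e, 1:]))"

lemma eigenvalues:
  assumes "real_symmetric n B"
  shows "length (eigenvalues B) = n" "char_poly B = (\<Prod>e\<leftarrow>eigenvalues B. [:- e, 1:])"
proof -
  have "dim_row B = n" using assms by (auto simp: real_symmetric_def)
  then have "length (eigenvalues B) = n \<and> char_poly B = (\<Prod>e\<leftarrow>eigenvalues B. [:- e, 1:])"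
    unfolding eigenvalues_def
    using someI_ex[OF real_symmetric_char_poly_splits[OF assms]] by simp
  then show "length (eigenvalues B) = n" "char_poly B = (\<Prod>e\<leftarrow>eigenvalues B. [:- e, 1:])"
    by auto
qed

lemma esd_integral_eigenvalues:
  fixes f :: "real \<Rightarrow> 'b::{banach, second_countable_topology}"
  assumes "real_symmetric n B" "n > 0" "f \<in> borel_measurable borel"
  shows "(\<integral>x. f x \<partial>esd B) = (1 / real n) *\<^sub>R (\<Sum>i<n. f (eigenvalues B ! i))"
proof -
  have "eigenvalues B \<noteq> []" using eigenvalues(1)[OF assms(1)] assms(2) by auto
  from esd_integral[OF eigenvalues(2)[OF assms(1)] this assms(3)] show ?thesis
    by (simp add: eigenvalues(1)[OF assms(1)] sum_list_sum_nth atLeast0LessThan)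
qed

lemma stieltjes_esd:
  assumes B: "real_symmetric n B" and n: "n > 0" and z: "Im z > 0"
  shows "stieltjes (esd B) z = mtrace (resolvent B z) / of_nat n"
proof -
  have "stieltjes (esd B) z = (1 / real n) *\<^sub>R (\<Sum>i<n. 1 / (complex_of_real (eigenvalues B ! i) - z))"
    unfolding stieltjes_def by (rule esd_integral_eigenvalues[OF B n]) measurable
  also have "(\<Sum>i<n. 1 / (complex_of_real (eigenvalues B ! i) - z)) = mtrace (resolvent B z)"
    using mtrace_resolvent_eigenvalues[OF B z eigenvalues(2)[OF B]] eigenvalues(1)[OF B]
    by (simp add: sum_list_sum_nth atLeast0LessThan)
  finally show ?thesis by (simp add: scaleR_conv_of_real)
qed

definition random_symmetric :: "'a measure \<Rightarrow> nat \<Rightarrow> ('a \<Rightarrow> real mat) \<Rightarrow> bool" where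
  "random_symmetric P n B \<longleftrightarrow> (\<forall>\<omega>. real_symmetric n (B \<omega>)) \<and>
     (\<forall>i<n. \<forall>j<n. (\<lambda>\<omega>. B \<omega> $$ (i, j)) \<in> borel_measurable P)"

lemma random_symmetric_pow_measurable:
  assumes B: "random_symmetric P n B" and "i < n" "j < n"
  shows "(\<lambda>\<omega>. (B \<omega> ^\<^sub>m m) $$ (i, j)) \<in> borel_measurable P"
  using assms(2,3)
proof (induction m arbitrary: i j)
  case 0
  have "dim_row (B \<omega>) = n" for \<omega> using B by (auto simp: random_symmetric_def real_symmetric_def)
  then have "(\<lambda>\<omega>. (B \<omega> ^\<^sub>m 0) $$ (i, j)) = (\<lambda>\<omega>. 1\<^sub>m n $$ (i, j))"
    by simp
  then show ?case by simp
next
  case (Suc m)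
  have C: "B \<omega> \<in> carrier_mat n n" for \<omega> using B by (auto simp: random_symmetric_def real_symmetric_def)
  have "(B \<omega> ^\<^sub>m Suc m) $$ (i, j) = (\<Sum>k<n. (B \<omega> ^\<^sub>m m) $$ (i, k) * B \<omega> $$ (k, j))" for \<omega>
    using index_mult_mat_sum[OF pow_carrier_mat[OF C] C Suc.prems] by simp
  moreover have "(\<lambda>\<omega>. \<Sum>k<n. (B \<omega> ^\<^sub>m m) $$ (i, k) * B \<omega> $$ (k, j)) \<in> borel_measurable P"
    using Suc B by (intro borel_measurable_sum borel_measurable_times) (auto simp: random_symmetric_def)
  ultimately show ?case by simp
qed

text \<open>
  Power sums are traces of powers, hence measurable, and so are sums of polynomials in the eigenvalues.
  A continuous \<open>f\<close> is the pointwise limit of polynomials $g_m$ that are $1/(m+1)$-close to it on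
  $[-m, m]$, and pointwise limits suffice because the number of eigenvalues is fixed.
\<close>
lemma random_symmetric_eigenvalue_sum_measurable:
  fixes f :: "real \<Rightarrow> real"
  assumes B: "random_symmetric P n B" and f: "continuous_on UNIV f"
  shows "(\<lambda>\<omega>. \<Sum>i<n. f (eigenvalues (B \<omega>) ! i)) \<in> borel_measurable P"
proof -
  have sym: "real_symmetric n (B \<omega>)" for \<omega> using B by (auto simp: random_symmetric_def)
  then have C: "B \<omega> \<in> carrier_mat n n" for \<omega> by (auto simp: real_symmetric_def)
  have pow: "(\<lambda>\<omega>. \<Sum>i<n. (eigenvalues (B \<omega>) ! i) ^ m) \<in> borel_measurable P" for m
  proof -
    have "(\<Sum>i<n. (eigenvalues (B \<omega>) ! i) ^ m) = (\<Sum>i<n. (B \<omega> ^\<^sub>m m) $$ (i, i))" for \<omega>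
      using mtrace_pow_eigenvalues[OF C eigenvalues(2)[OF sym], of \<omega> m] eigenvalues(1)[OF sym, of \<omega>]
        carrier_matD(1)[OF C, of \<omega>]
      by (simp add: sum_list_sum_nth atLeast0LessThan mtrace_def)
    then show ?thesis
      using random_symmetric_pow_measurable[OF B] by (auto intro!: borel_measurable_sum)
  qed
  have poly: "(\<lambda>\<omega>. \<Sum>i<n. g (eigenvalues (B \<omega>) ! i)) \<in> borel_measurable P"
    if "real_polynomial_function g" for g
  proof -
    have "\<exists>a d. g = (\<lambda>x. \<Sum>m\<le>d. a m * x ^ m)"
      using that by (simp only: real_polynomial_function_iff_sum)
    then obtain a d where g: "g = (\<lambda>x. \<Sum>m\<le>d. a m * x ^ m)"
      by (elim exE)
    have "(\<Sum>i<n. g (eigenvalues (B \<omega>) ! i)) = (\<Sum>m\<le>d. a m * (\<Sum>i<n. (eigenvalues (B \<omega>) ! i) ^ m))" for \<omega>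
      unfolding g sum_distrib_left by (rule sum.swap)
    then show ?thesis using pow by (auto intro!: borel_measurable_sum borel_measurable_times)
  qed
  have "\<exists>g. real_polynomial_function g \<and> (\<forall>x\<in>{- real m..real m}. \<bar>f x - g x\<bar> < 1 / real (Suc m))" for m
  proof -
    have c: "continuous_on {- real m..real m} f" using f by (rule continuous_on_subset) simp
    have pos: "0 < 1 / real (Suc m)" by simp
    show ?thesis
      by (rule Stone_Weierstrass_real_polynomial_function[OF compact_Icc c pos]) blast
  qed
  then have "\<exists>g. \<forall>m. real_polynomial_function (g m) \<and>
      (\<forall>x\<in>{- real m..real m}. \<bar>f x - g m x\<bar> < 1 / real (Suc m))"
    by (intro choice allI)
  then obtain g where "\<forall>m. real_polynomial_function (g m) \<and>
      (\<forall>x\<in>{- real m..real m}. \<bar>f x - g m x\<bar> < 1 / real (Suc m))"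
    by (elim exE)
  then have g: "\<And>m. real_polynomial_function (g m)"
    and fg: "\<And>m x. x \<in> {- real m..real m} \<Longrightarrow> \<bar>f x - g m x\<bar> < 1 / real (Suc m)"
    by blast+
  have lim: "(\<lambda>m. g m x) \<longlonglongrightarrow> f x" for x
  proof -
    obtain N where N: "\<bar>x\<bar> \<le> real N" using real_arch_simple by blast
    have "(\<lambda>m. g m x - f x) \<longlonglongrightarrow> 0"
    proof (rule Lim_null_comparison[OF _ lim_inverse_n'])
      have "norm (g m x - f x) \<le> 1 / real m" if "m \<ge> Suc N" for m
      proof -
        have "\<bar>f x - g m x\<bar> < 1 / real (Suc m)" using N that by (intro fg) auto
        also have "\<dots> \<le> 1 / real m" using that by (intro divide_left_mono) auto
        finally show ?thesis by simp
      qed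
      then show "\<forall>\<^sub>F m in sequentially. norm (g m x - f x) \<le> 1 / real m"
        by (rule eventually_sequentiallyI)
    qed
    then show ?thesis by (simp add: LIM_zero_iff)
  qed
  show ?thesis
  proof (rule borel_measurable_LIMSEQ_real)
    show "(\<lambda>m. \<Sum>i<n. g m (eigenvalues (B \<omega>) ! i)) \<longlonglongrightarrow> (\<Sum>i<n. f (eigenvalues (B \<omega>) ! i))" for \<omega>
      by (intro tendsto_sum lim)
  qed (rule poly[OF g])
qed

text \<open>
  Half-lines generate the Borel sets, and their indicators are pointwise limits of continuous step
  functions.
\<close>
lemma random_symmetric_esd_kernel:
  assumes B: "random_symmetric P n B" and n: "n > 0"
  shows "(\<lambda>\<omega>. esd (B \<omega>)) \<in> measurable P (prob_algebra borel)"
proof (rule measurable_prob_algebra_generated[where G = "range atMost" and \<Omega> = UNIV])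
  show "Int_stable (range (atMost :: real \<Rightarrow> real set))"
    by (auto simp: Int_stable_def)
  show "sets (borel :: real measure) = sigma_sets UNIV (range atMost)"
    by (simp add: borel_eq_atMost)
  fix A :: "real set" assume "A \<in> range atMost"
  then obtain a where A: "A = {..a}" by auto
  have sym: "real_symmetric n (B \<omega>)" for \<omega> using B by (auto simp: random_symmetric_def)
  have lim: "(\<lambda>m. cts_step a (a + 1 / real (Suc m)) x) \<longlonglongrightarrow> indicator A x" for x
  proof (cases "x \<le> a")
    case False
    then obtain N where N: "1 / real (Suc N) < x - a"
      using reals_Archimedean[of "x - a"] by (auto simp: inverse_eq_divide)
    have "cts_step a (a + 1 / real (Suc m)) x = 0" if "m \<ge> N" for m
    proof -
      have "1 / real (Suc m) \<le> 1 / real (Suc N)" using that by (intro divide_left_mono) auto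
      then show ?thesis using N False by (auto simp: cts_step_def)
    qed
    then have "\<forall>\<^sub>F m in sequentially. cts_step a (a + 1 / real (Suc m)) x = 0"
      by (rule eventually_sequentiallyI)
    then show ?thesis using False by (simp add: A tendsto_eventually)
  qed (simp add: cts_step_def A)
  have "(\<lambda>\<omega>. \<Sum>i<n. indicat_real A (eigenvalues (B \<omega>) ! i)) \<in> borel_measurable P"
  proof (rule borel_measurable_LIMSEQ_real)
    show "(\<lambda>m. \<Sum>i<n. cts_step a (a + 1 / real (Suc m)) (eigenvalues (B \<omega>) ! i))
        \<longlonglongrightarrow> (\<Sum>i<n. indicat_real A (eigenvalues (B \<omega>) ! i))" for \<omega>
      by (intro tendsto_sum lim)
    have "continuous_on UNIV (cts_step a (a + 1 / real (Suc m)))" for m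
      by (intro uniformly_continuous_imp_continuous cts_step_uniformly_continuous) simp
    then show "(\<lambda>\<omega>. \<Sum>i<n. cts_step a (a + 1 / real (Suc m)) (eigenvalues (B \<omega>) ! i))
        \<in> borel_measurable P" for m
      by (rule random_symmetric_eigenvalue_sum_measurable[OF B])
  qed
  then have "(\<lambda>\<omega>. ennreal (1 / real n * (\<Sum>i<n. indicat_real A (eigenvalues (B \<omega>) ! i)))) \<in> borel_measurable P"
    by (intro measurable_compose[OF _ measurable_ennreal] borel_measurable_times borel_measurable_const)
  moreover have "emeasure (esd (B \<omega>)) A = ennreal (1 / real n * (\<Sum>i<n. indicat_real A (eigenvalues (B \<omega>) ! i)))" for \<omega>
  proof -
    interpret prob_space "esd (B \<omega>)" by (rule esd_properties)
    have "measure (esd (B \<omega>)) A = (\<integral>x. indicat_real A x \<partial>esd (B \<omega>))"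
      unfolding A by (subst Bochner_Integration.integral_indicator) (simp_all only: esd_properties Int_UNIV_right)
    also have "\<dots> = 1 / real n * (\<Sum>i<n. indicat_real A (eigenvalues (B \<omega>) ! i))"
      by (subst esd_integral_eigenvalues[OF sym n]) (auto simp: A)
    finally show ?thesis by (simp add: emeasure_eq_measure)
  qed
  ultimately show "(\<lambda>\<omega>. emeasure (esd (B \<omega>)) A) \<in> borel_measurable P" by (simp only:)
next
  show "range (atMost :: real \<Rightarrow> real set) \<subseteq> Pow UNIV" by auto
  fix \<omega>
  show "prob_space (esd (B \<omega>))" "sets (esd (B \<omega>)) = sets borel" by (fact esd_properties)+
qed

lemma real_distribution_eqI:
  fixes M N :: "real measure"
  assumes M: "real_distribution M" and N: "real_distribution N"
    and eq: "\<And>f :: real \<Rightarrow> real. continuous_on UNIV f \<Longrightarrow> bounded (range f) \<Longrightarrow> (\<integral>x. f x \<partial>M) = (\<integral>x. f x \<partial>N)"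
  shows "M = N"
proof (rule Levy_uniqueness[OF M N ext])
  fix t :: real
  have char: "char L t = Complex (\<integral>x. cos (t * x) \<partial>L) (\<integral>x. sin (t * x) \<partial>L)" if "real_distribution L" for L
  proof -
    interpret real_distribution L by fact
    have i: "integrable L (\<lambda>x. iexp (t * x))" by (rule integrable_iexp) auto
    have e: "exp (\<i> * (complex_of_real t * complex_of_real x)) = cis (t * x)" for x by (simp add: cis_conv_exp)
    have "Re (char L t) = (\<integral>x. cos (t * x) \<partial>L)"
      unfolding char_def using integral_Re[OF i] by (simp add: e)
    moreover have "Im (char L t) = (\<integral>x. sin (t * x) \<partial>L)"
      unfolding char_def using integral_Im[OF i] by (simp add: e)
    ultimately show ?thesis by (simp add: complex_eq_iff)
  qed
  have "(\<integral>x. cos (t * x) \<partial>M) = (\<integral>x. cos (t * x) \<partial>N)"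
    by (intro eq continuous_intros) (auto intro!: boundedI[of _ 1])
  moreover have "(\<integral>x. sin (t * x) \<partial>M) = (\<integral>x. sin (t * x) \<partial>N)"
    by (intro eq continuous_intros) (auto intro!: boundedI[of _ 1])
  ultimately show "char M t = char N t" by (simp add: char[OF M] char[OF N])
qed

text \<open>
  The random spectral distribution is a probability kernel, and mixing it over \<open>P\<close> gives a measure with
  the required integrals. Uniqueness holds because cosine and sine already determine a distribution,
  through its characteristic function.
\<close>
lemma mean_esd:
  assumes P: "prob_space P" and B: "random_symmetric P n B" and n: "n > 0"
  shows "real_distribution (mean_esd P B)"
    and "\<And>f :: real \<Rightarrow> real. continuous_on UNIV f \<Longrightarrow> bounded (range f) \<Longrightarrow>
      (\<integral>x. f x \<partial>mean_esd P B) = (\<integral>\<omega>. (\<integral>x. f x \<partial>esd (B \<omega>)) \<partial>P)"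
proof -
  interpret P: prob_space P by fact
  let ?K = "\<lambda>\<omega>. esd (B \<omega>)"
  define \<nu> where "\<nu> = P \<bind> ?K"
  have K: "?K \<in> measurable P (prob_algebra borel)" by (rule random_symmetric_esd_kernel[OF B n])
  then have Ks: "?K \<in> measurable P (subprob_algebra borel)" by (rule measurable_prob_algebraD)
  have \<nu>: "real_distribution \<nu>"
  proof (intro real_distribution.intro real_distribution_axioms.intro)
    have "P \<in> space (prob_algebra P)" by (simp add: space_prob_algebra P)
    then show "prob_space \<nu>" "sets \<nu> = sets borel"
      unfolding \<nu>_def by (rule prob_space_bind'[OF _ K], rule sets_bind'[OF _ K])
  qed
  have int: "(\<integral>x. f x \<partial>\<nu>) = (\<integral>\<omega>. (\<integral>x. f x \<partial>?K \<omega>) \<partial>P)"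
    if f: "continuous_on UNIV f" "bounded (range f)" for f :: "real \<Rightarrow> real"
  proof -
    have fm [measurable]: "f \<in> borel_measurable borel" by (rule borel_measurable_continuous_onI[OF f(1)])
    obtain b where b: "\<And>x. \<bar>f x\<bar> \<le> b" using f(2) by (auto simp: bounded_iff)
    interpret D: prob_space "distr P (subprob_algebra borel) ?K" by (rule P.prob_space_distr[OF Ks])
    have "(\<integral>x. f x \<partial>\<nu>) = (\<integral>M'. (\<integral>x. f x \<partial>M') \<partial>distr P (subprob_algebra borel) ?K)"
      unfolding \<nu>_def bind_nonempty''[OF Ks P.not_empty]
    proof (rule integral_join[where B = b and B' = 1 and N = borel])
      show "AE M' in distr P (subprob_algebra borel) ?K. emeasure M' (space M') \<le> ennreal 1"
        by (rule AE_I2) (auto simp: space_subprob_algebra intro: subprob_space.emeasure_space_le_1)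
    qed (auto simp: b D.finite_measure)
    also have "\<dots> = (\<integral>\<omega>. (\<integral>x. f x \<partial>?K \<omega>) \<partial>P)"
      by (rule integral_distr[OF Ks]) measurable
    finally show ?thesis .
  qed
  have "mean_esd P B = \<nu>"
    unfolding mean_esd_def
  proof (rule the_equality)
    fix \<mu>
    assume \<mu>: "real_distribution \<mu> \<and> (\<forall>f :: real \<Rightarrow> real. continuous_on UNIV f \<and> bounded (range f) \<longrightarrow>
        (\<integral>x. f x \<partial>\<mu>) = (\<integral>\<omega>. (\<integral>x. f x \<partial>esd (B \<omega>)) \<partial>P))"
    show "\<mu> = \<nu>" by (rule real_distribution_eqI) (use \<mu> \<nu> int in auto)
  qed (use \<nu> int in auto)
  then show "real_distribution (mean_esd P B)"
    and "\<And>f :: real \<Rightarrow> real. continuous_on UNIV f \<Longrightarrow> bounded (range f) \<Longrightarrow>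
      (\<integral>x. f x \<partial>mean_esd P B) = (\<integral>\<omega>. (\<integral>x. f x \<partial>esd (B \<omega>)) \<partial>P)"
    using \<nu> int by auto
qed

lemma cauchy_kernel:
  fixes z :: complex
  assumes z: "Im z > 0"
  shows "continuous_on UNIV (\<lambda>x. 1 / (complex_of_real x - z))"
    and "cmod (1 / (complex_of_real x - z)) \<le> 1 / Im z"
proof -
  have nz: "complex_of_real x - z \<noteq> 0" for x using z by (auto simp: complex_eq_iff)
  then show "continuous_on UNIV (\<lambda>x. 1 / (complex_of_real x - z))"
    by (intro continuous_intros) auto
  have "Im z \<le> cmod (complex_of_real x - z)"
    using abs_Im_le_cmod[of "complex_of_real x - z"] z by simp
  then show "cmod (1 / (complex_of_real x - z)) \<le> 1 / Im z"
    using z nz[of x] by (auto simp: norm_divide intro!: divide_left_mono mult_pos_pos)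
qed

lemma mtrace_resolvent_bounded_measurable:
  assumes B: "random_symmetric P n B" and z: "Im z > 0"
  shows "(\<lambda>\<omega>. mtrace (resolvent (B \<omega>) z)) \<in> borel_measurable P"
    and "cmod (mtrace (resolvent (B \<omega>) z)) \<le> real n / Im z"
proof -
  let ?g = "\<lambda>x. 1 / (complex_of_real x - z)"
  have sym: "real_symmetric n (B \<omega>)" for \<omega> using B by (auto simp: random_symmetric_def)
  have eq: "mtrace (resolvent (B \<omega>) z) = (\<Sum>i<n. ?g (eigenvalues (B \<omega>) ! i))" for \<omega>
    using mtrace_resolvent_eigenvalues[OF sym z eigenvalues(2)[OF sym]] eigenvalues(1)[OF sym]
    by (simp add: sum_list_sum_nth atLeast0LessThan)
  note cont = cauchy_kernel(1)[OF z]
  show "(\<lambda>\<omega>. mtrace (resolvent (B \<omega>) z)) \<in> borel_measurable P"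
    unfolding borel_measurable_complex_iff eq Re_sum Im_sum
    by (intro conjI random_symmetric_eigenvalue_sum_measurable[OF B] continuous_on_Re continuous_on_Im cont)
  have "cmod (\<Sum>i<n. ?g (eigenvalues (B \<omega>) ! i)) \<le> of_nat (card {..<n}) * (1 / Im z)"
    by (rule sum_norm_bound) (rule cauchy_kernel(2)[OF z])
  then show "cmod (mtrace (resolvent (B \<omega>) z)) \<le> real n / Im z"
    unfolding eq by simp
qed

text \<open>
  The Cauchy kernel is complex valued whereas the mean measure is characterised by real test functions,
  so real and imaginary parts are treated separately.
\<close>
proposition stieltjes_mean_esd:
  assumes P: "prob_space P" and B: "random_symmetric P n B" and n: "n > 0" and z: "Im z > 0"
  shows "stieltjes (mean_esd P B) z = (\<integral>\<omega>. mtrace (resolvent (B \<omega>) z) / of_nat n \<partial>P)"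
proof -
  let ?g = "\<lambda>x. 1 / (complex_of_real x - z)"
  interpret P: prob_space P by fact
  have sym: "real_symmetric n (B \<omega>)" for \<omega> using B by (auto simp: random_symmetric_def)
  note cont = cauchy_kernel(1)[OF z]
  have gm: "?g \<in> borel_measurable borel" by (rule borel_measurable_continuous_onI[OF cont])
  have int: "integrable M ?g" if "prob_space M" "sets M = sets borel" for M
  proof -
    interpret prob_space M by fact
    show ?thesis
      by (rule integrable_const_bound[of _ "1 / Im z"])
         (use cauchy_kernel(2)[OF z] gm in \<open>auto cong: measurable_cong_sets simp: that(2)\<close>)
  qed
  interpret \<mu>: real_distribution "mean_esd P B" by (rule mean_esd(1)[OF P B n])
  have i\<mu>: "integrable (mean_esd P B) ?g" by (rule int) (auto intro: \<mu>.prob_space_axioms)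
  have iE: "integrable (esd (B \<omega>)) ?g" for \<omega> by (rule int) (auto simp: esd_properties)
  have tr: "stieltjes (esd (B \<omega>)) z = mtrace (resolvent (B \<omega>) z) / of_nat n" for \<omega>
    by (rule stieltjes_esd[OF sym n z])
  have iP: "integrable P (\<lambda>\<omega>. mtrace (resolvent (B \<omega>) z) / of_nat n)"
    using mtrace_resolvent_bounded_measurable[OF B z] n
    by (intro P.integrable_const_bound[of _ "1 / Im z"]) (auto simp: norm_divide divide_simps mult.commute)
  have bRe: "bounded (range (\<lambda>x. Re (?g x)))" and bIm: "bounded (range (\<lambda>x. Im (?g x)))"
    using order_trans[OF abs_Re_le_cmod cauchy_kernel(2)[OF z]]
      order_trans[OF abs_Im_le_cmod cauchy_kernel(2)[OF z]]
    by (auto intro!: boundedI[of _ "1 / Im z"] simp del: Re_divide Im_divide)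
  have "Re (stieltjes (mean_esd P B) z) = (\<integral>\<omega>. Re (stieltjes (esd (B \<omega>)) z) \<partial>P)"
    unfolding stieltjes_def integral_Re[OF i\<mu>, symmetric] integral_Re[OF iE, symmetric]
    by (rule mean_esd(2)[OF P B n continuous_on_Re[OF cont] bRe])
  moreover have "Im (stieltjes (mean_esd P B) z) = (\<integral>\<omega>. Im (stieltjes (esd (B \<omega>)) z) \<partial>P)"
    unfolding stieltjes_def integral_Im[OF i\<mu>, symmetric] integral_Im[OF iE, symmetric]
    by (rule mean_esd(2)[OF P B n continuous_on_Im[OF cont] bIm])
  ultimately show ?thesis
    using integral_Re[OF iP] integral_Im[OF iP] by (simp add: complex_eq_iff tr del: Re_divide Im_divide)
qed

section \<open>Lindeberg replacement in a product measure\<close>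

lemma norm_integral_le_integral:
  fixes f :: "'a \<Rightarrow> 'b::{banach, second_countable_topology}"
  assumes "integrable M f" "integrable M g" "\<And>x. x \<in> space M \<Longrightarrow> norm (f x) \<le> g x"
  shows "norm (\<integral>x. f x \<partial>M) \<le> (\<integral>x. g x \<partial>M)"
proof -
  have "norm (\<integral>x. f x \<partial>M) \<le> (\<integral>x. norm (f x) \<partial>M)"
    by (rule Bochner_Integration.integral_norm_bound)
  also have "\<dots> \<le> (\<integral>x. g x \<partial>M)"
    by (rule Bochner_Integration.integral_mono) (use assms in auto)
  finally show ?thesis .
qed

text \<open>
  Both laws give the same integral to a quadratic polynomial, so only the remainders count. The
  coefficients may depend on the other coordinates in any way whatsoever: they are constants here,
  and only the remainder bound survives into the subsequent integration.
\<close>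
lemma matching_moments_swap:
  fixes \<phi> :: "real \<Rightarrow> complex"
  assumes L: "prob_space L" "sets L = sets borel" "integrable L (\<lambda>x. x)" "integrable L (\<lambda>x. x\<^sup>2)"
    and L': "prob_space L'" "sets L' = sets borel" "integrable L' (\<lambda>x. x)" "integrable L' (\<lambda>x. x\<^sup>2)"
    and m1: "(\<integral>x. x \<partial>L) = (\<integral>x. x \<partial>L')" and m2: "(\<integral>x. x\<^sup>2 \<partial>L) = (\<integral>x. x\<^sup>2 \<partial>L')"
    and \<phi>: "\<phi> \<in> borel_measurable borel" "\<And>t. cmod (\<phi> t) \<le> K"
    and taylor: "\<And>t. cmod (\<phi> t - (c + complex_of_real t * a + (complex_of_real t)\<^sup>2 * b)) \<le> \<rho> t"
    and \<rho>: "integrable L \<rho>" "integrable L' \<rho>"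
  shows "cmod ((\<integral>t. \<phi> t \<partial>L) - (\<integral>t. \<phi> t \<partial>L')) \<le> (\<integral>t. \<rho> t \<partial>L) + (\<integral>t. \<rho> t \<partial>L')"
proof -
  let ?q = "\<lambda>t. c + complex_of_real t * a + (complex_of_real t)\<^sup>2 * b"
  have one: "(\<integral>t. ?q t \<partial>M) = c + complex_of_real (\<integral>x. x \<partial>M) * a + complex_of_real (\<integral>x. x\<^sup>2 \<partial>M) * b"
     "cmod ((\<integral>t. \<phi> t \<partial>M) - (\<integral>t. ?q t \<partial>M)) \<le> (\<integral>t. \<rho> t \<partial>M)"
    if M: "prob_space M" "sets M = sets borel" "integrable M (\<lambda>x. x)" "integrable M (\<lambda>x. x\<^sup>2)" "integrable M \<rho>" for M
  proof -
    interpret prob_space M by fact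
    have i1: "integrable M (\<lambda>t. complex_of_real t * a)"
      using M(3) by (intro integrable_mult_left integrable_of_real) simp
    have i2: "integrable M (\<lambda>t. complex_of_real (t\<^sup>2) * b)"
      using M(4) by (intro integrable_mult_left integrable_of_real) simp
    have iq: "integrable M ?q"
      using i1 i2 by simp
    have i\<phi>: "integrable M \<phi>"
      by (rule integrable_const_bound[of _ K]) (use \<phi> in \<open>auto cong: measurable_cong_sets simp: M(2)\<close>)
    have "(\<integral>t. ?q t \<partial>M) = c + (\<integral>t. complex_of_real t * a \<partial>M) + (\<integral>t. complex_of_real (t\<^sup>2) * b \<partial>M)"
      using i1 i2 by (simp add: prob_space)
    also have "(\<integral>t. complex_of_real t * a \<partial>M) = complex_of_real (\<integral>x. x \<partial>M) * a"
      by simp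
    also have "(\<integral>t. complex_of_real (t\<^sup>2) * b \<partial>M) = complex_of_real (\<integral>x. x\<^sup>2 \<partial>M) * b"
      by (simp del: of_real_power)
    finally show "(\<integral>t. ?q t \<partial>M) = c + complex_of_real (\<integral>x. x \<partial>M) * a + complex_of_real (\<integral>x. x\<^sup>2 \<partial>M) * b" .
    have "(\<integral>t. \<phi> t \<partial>M) - (\<integral>t. ?q t \<partial>M) = (\<integral>t. \<phi> t - ?q t \<partial>M)"
      by (rule Bochner_Integration.integral_diff[OF i\<phi> iq, symmetric])
    also have "cmod \<dots> \<le> (\<integral>t. \<rho> t \<partial>M)"
      by (rule norm_integral_le_integral) (use i\<phi> iq M(5) taylor in auto)
    finally show "cmod ((\<integral>t. \<phi> t \<partial>M) - (\<integral>t. ?q t \<partial>M)) \<le> (\<integral>t. \<rho> t \<partial>M)" .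
  qed
  have "(\<integral>t. ?q t \<partial>L) = (\<integral>t. ?q t \<partial>L')"
    unfolding one(1)[OF L \<rho>(1)] one(1)[OF L' \<rho>(2)] m1 m2 ..
  then have "(\<integral>t. \<phi> t \<partial>L) - (\<integral>t. \<phi> t \<partial>L')
      = ((\<integral>t. \<phi> t \<partial>L) - (\<integral>t. ?q t \<partial>L)) - ((\<integral>t. \<phi> t \<partial>L') - (\<integral>t. ?q t \<partial>L'))" by simp
  also have "cmod \<dots> \<le> (\<integral>t. \<rho> t \<partial>L) + (\<integral>t. \<rho> t \<partial>L')"
    by (rule order_trans[OF norm_triangle_ineq4 add_mono[OF one(2)[OF L \<rho>(1)] one(2)[OF L' \<rho>(2)]]])
  finally show ?thesis .
qed

text \<open>
  Fubini's theorem integrates the exchanged coordinate first; the outer integral is then the same for both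
  products.
\<close>
lemma product_integral_change_factor:
  fixes F :: "('i \<Rightarrow> real) \<Rightarrow> complex"
  assumes I: "finite I" "l \<in> I"
    and L: "\<And>i. prob_space (L i)" "\<And>i. sets (L i) = sets borel"
    and L': "\<And>i. prob_space (L' i)" "\<And>i. sets (L' i) = sets borel"
    and same: "\<And>i. i \<in> I \<Longrightarrow> i \<noteq> l \<Longrightarrow> L i = L' i"
    and F: "F \<in> borel_measurable (PiM I (\<lambda>_. borel))" "\<And>x. cmod (F x) \<le> K"
    and swap: "\<And>x. (\<lambda>t. F (x(l := t))) \<in> borel_measurable borel \<Longrightarrow>
        cmod ((\<integral>t. F (x(l := t)) \<partial>L l) - (\<integral>t. F (x(l := t)) \<partial>L' l)) \<le> \<delta>"
  shows "cmod ((\<integral>x. F x \<partial>PiM I L) - (\<integral>x. F x \<partial>PiM I L')) \<le> \<delta>"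
proof -
  define J where "J = I - {l}"
  have J: "finite J" "l \<notin> J" "insert l J = I" using I by (auto simp: J_def)
  have PJ: "PiM J L = PiM J L'" by (rule PiM_cong) (auto simp: J_def same)
  interpret PJ: prob_space "PiM J L" by (rule prob_space_PiM) (rule L)
  have int: "integrable (PiM I M) F" "(\<integral>x. F x \<partial>PiM I M) = (\<integral>x. (\<integral>t. F (x(l := t)) \<partial>M l) \<partial>PiM J M)"
    "integrable (PiM J M) (\<lambda>x. \<integral>t. F (x(l := t)) \<partial>M l)"
    "\<And>x. x \<in> space (PiM J M) \<Longrightarrow> (\<lambda>t. F (x(l := t))) \<in> borel_measurable borel"
    if M: "\<And>i. prob_space (M i)" "\<And>i. sets (M i) = sets borel" for M
  proof -
    interpret product_prob_space M by (rule product_prob_spaceI) (rule M)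
    have fin: "finite_measure (PiM A M)" for A
      by (intro prob_space.finite_measure prob_space_PiM M)
    have sets: "sets (PiM I M) = sets (PiM I (\<lambda>_. borel))" by (rule sets_PiM_cong) (auto simp: M)
    have Fm: "F \<in> borel_measurable (PiM I M)"
      using F(1) by (simp cong: measurable_cong_sets add: sets)
    show "integrable (PiM I M) F"
      by (rule finite_measure.integrable_const_bound[OF fin, of _ K]) (use Fm F(2) in auto)
    then show "(\<integral>x. F x \<partial>PiM I M) = (\<integral>x. (\<integral>t. F (x(l := t)) \<partial>M l) \<partial>PiM J M)"
      using product_integral_insert[OF J(1,2), of F] J(3) by simp
    have "(\<lambda>(x, t). F (x(l := t))) \<in> borel_measurable (PiM J M \<Otimes>\<^sub>M M l)"
      using measurable_compose[OF measurable_add_dim, of F l J M] Fm J(3) by (simp add: split_beta')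
    then have meas: "(\<lambda>x. \<integral>t. F (x(l := t)) \<partial>M l) \<in> borel_measurable (PiM J M)"
      by (rule sigma_finite_measure.borel_measurable_lebesgue_integral[OF prob_space_imp_sigma_finite[OF M(1)]])
    have upd: "(\<lambda>t. F (x(l := t))) \<in> borel_measurable (M l)" if "x \<in> space (PiM J M)" for x
      using measurable_compose[OF measurable_component_update[OF that J(2)], of F] Fm J(3) by simp
    then show "\<And>x. x \<in> space (PiM J M) \<Longrightarrow> (\<lambda>t. F (x(l := t))) \<in> borel_measurable borel"
      by (simp cong: measurable_cong_sets add: M(2))
    have "cmod (\<integral>t. F (x(l := t)) \<partial>M l) \<le> K" if x: "x \<in> space (PiM J M)" for x
    proof -
      have "cmod (\<integral>t. F (x(l := t)) \<partial>M l) \<le> (\<integral>t. K \<partial>M l)"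
        by (rule norm_integral_le_integral) (use F(2) upd[OF x] in \<open>auto intro!: finite_measure.integrable_const_bound[OF prob_space.finite_measure[OF M(1)], of _ K] prob_space.finite_measure[OF M(1)]\<close>)
      then show ?thesis by (simp add: prob_space.prob_space[OF M(1)])
    qed
    then show "integrable (PiM J M) (\<lambda>x. \<integral>t. F (x(l := t)) \<partial>M l)"
      by (intro finite_measure.integrable_const_bound[OF fin, of _ K] meas) auto
  qed
  have "(\<integral>x. F x \<partial>PiM I L) - (\<integral>x. F x \<partial>PiM I L')
      = (\<integral>x. (\<integral>t. F (x(l := t)) \<partial>L l) - (\<integral>t. F (x(l := t)) \<partial>L' l) \<partial>PiM J L)"
    unfolding int(2)[of L, OF L] int(2)[of L', OF L'] PJ
    by (rule Bochner_Integration.integral_diff[symmetric])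
       (use int(3)[of L, OF L] int(3)[of L', OF L'] in \<open>simp_all add: PJ\<close>)
  also have "cmod \<dots> \<le> (\<integral>x. \<delta> \<partial>PiM J L)"
    by (rule norm_integral_le_integral)
       (use int(3)[of L, OF L] int(3)[of L', OF L'] int(4)[of L, OF L] swap in \<open>auto simp: PJ[symmetric]\<close>)
  finally show ?thesis by (simp add: PJ.prob_space)
qed

text \<open>
  The measures with the factors in \<open>J\<close> exchanged interpolate between the two products; enlarging
  \<open>J\<close> by one index changes a single factor, to which the one-dimensional comparison applies with the
  other coordinates held fixed.
\<close>
proposition lindeberg_replacement:
  fixes F :: "('i \<Rightarrow> real) \<Rightarrow> complex"
  assumes I: "finite I"
    and L: "\<And>i. prob_space (L i)" "\<And>i. sets (L i) = sets borel"
      "\<And>i. integrable (L i) (\<lambda>x. x)" "\<And>i. integrable (L i) (\<lambda>x. x\<^sup>2)"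
    and L': "\<And>i. prob_space (L' i)" "\<And>i. sets (L' i) = sets borel"
      "\<And>i. integrable (L' i) (\<lambda>x. x)" "\<And>i. integrable (L' i) (\<lambda>x. x\<^sup>2)"
    and m1: "\<And>i. (\<integral>x. x \<partial>L i) = (\<integral>x. x \<partial>L' i)" and m2: "\<And>i. (\<integral>x. x\<^sup>2 \<partial>L i) = (\<integral>x. x\<^sup>2 \<partial>L' i)"
    and F: "F \<in> borel_measurable (PiM I (\<lambda>_. borel))" "\<And>x. cmod (F x) \<le> K"
    and taylor: "\<And>i x. i \<in> I \<Longrightarrow> \<exists>c a b. \<forall>t.
        cmod (F (x(i := t)) - (c + complex_of_real t * a + (complex_of_real t)\<^sup>2 * b)) \<le> \<rho> i t"
    and \<rho>: "\<And>i. i \<in> I \<Longrightarrow> integrable (L i) (\<rho> i)" "\<And>i. i \<in> I \<Longrightarrow> integrable (L' i) (\<rho> i)"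
  shows "cmod ((\<integral>x. F x \<partial>PiM I L) - (\<integral>x. F x \<partial>PiM I L'))
      \<le> (\<Sum>i\<in>I. (\<integral>t. \<rho> i t \<partial>L i) + (\<integral>t. \<rho> i t \<partial>L' i))"
proof -
  define H where "H J i = (if i \<in> J then L' i else L i)" for J i
  have H: "prob_space (H J i)" "sets (H J i) = sets borel" for J i
    using L L' by (auto simp: H_def)
  have "cmod ((\<integral>x. F x \<partial>PiM I L) - (\<integral>x. F x \<partial>PiM I (H J)))
      \<le> (\<Sum>i\<in>J. (\<integral>t. \<rho> i t \<partial>L i) + (\<integral>t. \<rho> i t \<partial>L' i))" if "J \<subseteq> I" for J
    using finite_subset[OF that I] that
  proof (induction J rule: finite_induct)
    case empty
    have "PiM I (H {}) = PiM I L" by (rule PiM_cong) (auto simp: H_def)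
    then show ?case by simp
  next
    case (insert l J)
    let ?d = "(\<integral>t. \<rho> l t \<partial>L l) + (\<integral>t. \<rho> l t \<partial>L' l)"
    have l: "l \<in> I" using insert.prems by simp
    have "cmod ((\<integral>x. F x \<partial>PiM I (H J)) - (\<integral>x. F x \<partial>PiM I (H (insert l J)))) \<le> ?d"
    proof (rule product_integral_change_factor[OF I l H H _ F])
      fix x assume meas: "(\<lambda>t. F (x(l := t))) \<in> borel_measurable borel"
      obtain c a b where "\<And>t. cmod (F (x(l := t)) - (c + complex_of_real t * a + (complex_of_real t)\<^sup>2 * b)) \<le> \<rho> l t"
        using taylor[OF l, of x] by blast
      from matching_moments_swap[OF L L' m1 m2 meas F(2) this \<rho>[OF l]]
      show "cmod ((\<integral>t. F (x(l := t)) \<partial>H J l) - (\<integral>t. F (x(l := t)) \<partial>H (insert l J) l)) \<le> ?d"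
        using insert.hyps by (simp add: H_def)
    qed (auto simp: H_def)
    moreover have "cmod ((\<integral>x. F x \<partial>PiM I L) - (\<integral>x. F x \<partial>PiM I (H (insert l J))))
        \<le> cmod ((\<integral>x. F x \<partial>PiM I L) - (\<integral>x. F x \<partial>PiM I (H J)))
          + cmod ((\<integral>x. F x \<partial>PiM I (H J)) - (\<integral>x. F x \<partial>PiM I (H (insert l J))))"
      by (rule norm_diff_triangle_ineq[THEN order_trans[rotated]]) simp
    ultimately show ?case using insert by simp
  qed
  from this[OF subset_refl] have "cmod ((\<integral>x. F x \<partial>PiM I L) - (\<integral>x. F x \<partial>PiM I (H I)))
      \<le> (\<Sum>i\<in>I. (\<integral>t. \<rho> i t \<partial>L i) + (\<integral>t. \<rho> i t \<partial>L' i))" .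
  moreover have "PiM I (H I) = PiM I L'" by (rule PiM_cong) (auto simp: H_def)
  ultimately show ?thesis by simp
qed

section \<open>Replacing the hyperedge variables one at a time\<close>

lemma index_H_mat:
  assumes "i < n" "j < n"
  shows "H_mat n k r p e x $$ (i, j) =
    (1 / sqrt (real n * sigma_sq n k r p)) * (\<Sum>l=1..num_edges n r k. x l * Q_mat n (e l) $$ (i, j))"
  using assms by (simp add: H_mat_def)

lemma Q_mat_symmetric: "real_symmetric n (Q_mat n S)"
  by (auto simp: real_symmetric_def Q_mat_def)

lemma H_mat_symmetric: "real_symmetric n (H_mat n k r p e x)"
proof -
  have "Q_mat n S $$ (i, j) = Q_mat n S $$ (j, i)" if "i < n" "j < n" for S i j
    using Q_mat_symmetric that unfolding real_symmetric_def by blast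
  then show ?thesis
    unfolding real_symmetric_def by (auto simp: index_H_mat) (simp add: H_mat_def)
qed

lemma H_mat_random_symmetric:
  assumes "\<And>l. l \<in> {1..num_edges n r k} \<Longrightarrow> (\<lambda>\<omega>. Y \<omega> l) \<in> borel_measurable P"
  shows "random_symmetric P n (\<lambda>\<omega>. H_mat n k r p e (Y \<omega>))"
  unfolding random_symmetric_def
  using assms by (auto simp: H_mat_symmetric index_H_mat intro!: borel_measurable_times borel_measurable_sum)

lemma H_mat_cong:
  assumes "\<And>l. l \<in> {1..num_edges n r k} \<Longrightarrow> x l = y l"
  shows "H_mat n k r p e x = H_mat n k r p e y"
proof -
  have "(\<Sum>l=1..num_edges n r k. x l * q l) = (\<Sum>l=1..num_edges n r k. y l * q l)" for q :: "nat \<Rightarrow> real"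
    using assms by (intro sum.cong) auto
  then show ?thesis by (simp add: H_mat_def)
qed

lemma H_mat_upd:
  assumes l: "l \<in> {1..num_edges n r k}"
  shows "H_mat n k r p e (x(l := t)) =
    H_mat n k r p e (x(l := 0)) + (t / sqrt (real n * sigma_sq n k r p)) \<cdot>\<^sub>m Q_mat n (e l)"
    (is "?A = ?B")
proof (rule eq_matI)
  have Qc: "Q_mat n (e l) \<in> carrier_mat n n"
    and Hc: "\<And>y. H_mat n k r p e y \<in> carrier_mat n n"
    using Q_mat_symmetric H_mat_symmetric by (auto simp: real_symmetric_def)
  show "dim_row ?A = dim_row ?B" "dim_col ?A = dim_col ?B" using Qc Hc by auto
  fix i j assume "i < dim_row ?B" "j < dim_col ?B"
  then have ij: "i < n" "j < n" using Qc by auto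
  have "(\<Sum>m=1..num_edges n r k. (x(l := t)) m * Q_mat n (e m) $$ (i, j))
      = (\<Sum>m=1..num_edges n r k. (x(l := 0)) m * Q_mat n (e m) $$ (i, j)
          + (if m = l then t * Q_mat n (e l) $$ (i, j) else 0))"
    by (intro sum.cong) auto
  then show "?A $$ (i, j) = ?B $$ (i, j)"
    using ij l Qc by (simp add: index_H_mat sum.distrib distrib_left)
qed

lemma Q_mat_supported:
  assumes "S \<subseteq> {1..n}"
  shows "supported_on n (Suc -` S) (Q_mat n S)" "card (Suc -` S) = card S"
proof -
  have "x \<in> range Suc" if "x \<in> S" for x using assms that by (cases x) auto
  then have "S \<subseteq> range Suc" by blast
  then show "card (Suc -` S) = card S" by (simp add: card_vimage_inj)
  show "supported_on n (Suc -` S) (Q_mat n S)"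
    using assms Q_mat_symmetric by (auto simp: supported_on_def) (auto simp: Q_mat_def)
qed

text \<open>
  The remainder bound for one entry of $H_n$: \<open>v\<close> is the imaginary part of the spectral parameter,
  \<open>\<tau>\<close> the normalisation, \<open>s\<close> the size of the hyperedge and \<open>t\<close> the value of its variable.
\<close>
definition swap_error :: "nat \<Rightarrow> real \<Rightarrow> real \<Rightarrow> nat \<Rightarrow> real \<Rightarrow> real" where
  "swap_error n v \<tau> s t =
     min (2 * real s ^ 4 / v ^ 3 * (t / \<tau>)\<^sup>2) (real s ^ 6 / v ^ 4 * \<bar>t / \<tau>\<bar> ^ 3) / real n"

lemma swap_error_bounds:
  assumes "v > 0" "\<tau> > 0"
  shows "0 \<le> swap_error n v \<tau> s t"
    "swap_error n v \<tau> s t \<le> 2 * real s ^ 4 / (v ^ 3 * \<tau>\<^sup>2 * real n) * t\<^sup>2"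
    "swap_error n v \<tau> s t \<le> real s ^ 6 / (v ^ 4 * \<tau> ^ 3 * real n) * \<bar>t\<bar> ^ 3"
proof -
  show "0 \<le> swap_error n v \<tau> s t" using assms by (simp add: swap_error_def)
  have "swap_error n v \<tau> s t \<le> (2 * real s ^ 4 / v ^ 3 * (t / \<tau>)\<^sup>2) / real n"
    unfolding swap_error_def by (intro divide_right_mono) auto
  then show "swap_error n v \<tau> s t \<le> 2 * real s ^ 4 / (v ^ 3 * \<tau>\<^sup>2 * real n) * t\<^sup>2"
    by (simp add: power_divide)
  have "swap_error n v \<tau> s t \<le> (real s ^ 6 / v ^ 4 * \<bar>t / \<tau>\<bar> ^ 3) / real n"
    unfolding swap_error_def by (intro divide_right_mono) auto
  then show "swap_error n v \<tau> s t \<le> real s ^ 6 / (v ^ 4 * \<tau> ^ 3 * real n) * \<bar>t\<bar> ^ 3"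
    using assms(2) by (simp add: power_divide abs_divide)
qed

lemma swap_error_measurable [measurable]: "swap_error n v \<tau> s \<in> borel_measurable borel"
  unfolding swap_error_def by measurable

lemma swap_error_integrable:
  assumes "v > 0" "\<tau> > 0" and M: "sets M = sets borel" "integrable M (\<lambda>t. t\<^sup>2)"
  shows "integrable M (swap_error n v \<tau> s)"
proof (rule Bochner_Integration.integrable_bound)
  show "integrable M (\<lambda>t. 2 * real s ^ 4 / (v ^ 3 * \<tau>\<^sup>2 * real n) * t\<^sup>2)" using M(2) by simp
  show "swap_error n v \<tau> s \<in> borel_measurable M"
    using swap_error_measurable by (simp cong: measurable_cong_sets add: M(1))
  show "AE t in M. norm (swap_error n v \<tau> s t) \<le> norm (2 * real s ^ 4 / (v ^ 3 * \<tau>\<^sup>2 * real n) * t\<^sup>2)"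
  proof (rule AE_I2)
    have "norm a \<le> norm b" if "0 \<le> a" "a \<le> b" for a b :: real using that by simp
    then show "norm (swap_error n v \<tau> s t) \<le> norm (2 * real s ^ 4 / (v ^ 3 * \<tau>\<^sup>2 * real n) * t\<^sup>2)" for t
      using swap_error_bounds(1,2)[OF assms(1,2), of n s t] by blast
  qed
qed

lemma resolvent_H_mat_taylor:
  assumes l: "l \<in> {1..num_edges n r k}" and el: "e l \<subseteq> {1..n}" and z: "Im z > 0" and n: "n > 0"
  shows "\<exists>c a b. \<forall>t. cmod (mtrace (resolvent (H_mat n k r p e (x(l := t))) z) / of_nat n
             - (c + complex_of_real t * a + (complex_of_real t)\<^sup>2 * b))
           \<le> swap_error n (Im z) (sqrt (real n * sigma_sq n k r p)) (card (e l)) t"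
proof -
  let ?\<tau> = "sqrt (real n * sigma_sq n k r p)" and ?H = "H_mat n k r p e (x(l := 0))" and ?Q = "Q_mat n (e l)"
  note Q = Q_mat_supported[OF el]
  obtain a b where ab: "\<And>t. cmod (mtrace (resolvent (?H + t \<cdot>\<^sub>m ?Q) z)
             - (mtrace (resolvent ?H z) + complex_of_real t * a + (complex_of_real t)\<^sup>2 * b))
           \<le> min (2 * real (card (e l)) ^ 4 / Im z ^ 3 * t\<^sup>2) (real (card (e l)) ^ 6 / Im z ^ 4 * \<bar>t\<bar> ^ 3)"
    using resolvent_trace_taylor[OF H_mat_symmetric Q(1) z, of k r p e "x(l := 0)"] unfolding Q(2) by blast
  have "cmod (mtrace (resolvent (H_mat n k r p e (x(l := t))) z) / of_nat n
      - (mtrace (resolvent ?H z) / of_nat n + complex_of_real t * (a / (complex_of_real ?\<tau> * of_nat n))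
          + (complex_of_real t)\<^sup>2 * (b / ((complex_of_real ?\<tau>)\<^sup>2 * of_nat n))))
      \<le> swap_error n (Im z) ?\<tau> (card (e l)) t" (is "cmod ?d \<le> _") for t
  proof -
    let ?s = "t / ?\<tau>"
    let ?D = "mtrace (resolvent (?H + ?s \<cdot>\<^sub>m ?Q) z)
             - (mtrace (resolvent ?H z) + complex_of_real ?s * a + (complex_of_real ?s)\<^sup>2 * b)"
    have "?d = ?D / of_nat n"
      unfolding H_mat_upd[OF l, of p e x t]
      by (simp add: diff_divide_distrib add_divide_distrib power_divide)
    then have "cmod ?d = cmod ?D / real n" by (simp add: norm_divide)
    then show ?thesis
      unfolding swap_error_def using divide_right_mono[OF ab[of ?s], of "real n"] by simp
  qed
  then show ?thesis by blast
qed

text \<open>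
  Outside the index set the law is a point mass, so that every index carries a probability measure and
  the product measure theory applies without side conditions.
\<close>
definition edge_law :: "'a measure \<Rightarrow> nat set \<Rightarrow> (nat \<Rightarrow> 'a \<Rightarrow> real) \<Rightarrow> nat \<Rightarrow> real measure" where
  "edge_law P I Y l = (if l \<in> I then distr P borel (Y l) else return borel 0)"

lemma edge_law_integral:
  fixes f :: "real \<Rightarrow> real"
  assumes "l \<in> I \<Longrightarrow> Y l \<in> borel_measurable P" "f \<in> borel_measurable borel"
  shows "(\<integral>x. f x \<partial>edge_law P I Y l) = (if l \<in> I then \<integral>\<omega>. f (Y l \<omega>) \<partial>P else f 0)"
  using assms by (simp add: edge_law_def integral_distr integral_return)

lemma edge_law_properties:
  assumes P: "prob_space P" and Y: "l \<in> I \<Longrightarrow> Y l \<in> borel_measurable P"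
    and Y2: "l \<in> I \<Longrightarrow> integrable P (\<lambda>\<omega>. (Y l \<omega>)\<^sup>2)"
  shows "prob_space (edge_law P I Y l)" "sets (edge_law P I Y l) = sets borel"
    "integrable (edge_law P I Y l) (\<lambda>x. x)" "integrable (edge_law P I Y l) (\<lambda>x. x\<^sup>2)"
proof -
  show p: "prob_space (edge_law P I Y l)"
  proof (cases "l \<in> I")
    case True
    then show ?thesis unfolding edge_law_def by (simp add: prob_space.prob_space_distr[OF P Y])
  next
    case False
    then show ?thesis unfolding edge_law_def by (simp add: prob_space_return)
  qed
  show s: "sets (edge_law P I Y l) = sets borel" by (simp add: edge_law_def)
  show i2: "integrable (edge_law P I Y l) (\<lambda>x. x\<^sup>2)"
  proof (cases "l \<in> I")
    case True
    then show ?thesis using Y Y2 by (simp add: edge_law_def integrable_distr_eq)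
  next
    case False
    interpret prob_space "return borel (0::real)" by (rule prob_space_return) simp
    have "integrable (return borel (0::real)) (\<lambda>x. x\<^sup>2)"
      by (rule integrable_const_bound[of _ 0]) (auto simp: AE_return)
    then show ?thesis using False by (simp add: edge_law_def)
  qed
  show "integrable (edge_law P I Y l) (\<lambda>x. x)"
    by (rule finite_measure.square_integrable_imp_integrable[OF prob_space.finite_measure[OF p] _ i2])
       (simp cong: measurable_cong_sets add: s)
qed

lemma H_mat_expectation_PiM:
  assumes P: "prob_space P" and Y: "prob_space.indep_vars P (\<lambda>_. borel) Y {1..num_edges n r k}"
    and M: "num_edges n r k > 0" and n: "n > 0" and z: "Im z > 0"
  shows "stieltjes (mean_esd P (\<lambda>\<omega>. H_mat n k r p e (\<lambda>l. Y l \<omega>))) z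
    = (\<integral>x. mtrace (resolvent (H_mat n k r p e x) z) / of_nat n \<partial>PiM {1..num_edges n r k} (edge_law P {1..num_edges n r k} Y))"
proof -
  let ?I = "{1..num_edges n r k}"
  let ?F = "\<lambda>x. mtrace (resolvent (H_mat n k r p e x) z) / of_nat n"
  interpret prob_space P by fact
  have rv: "\<And>l. l \<in> ?I \<Longrightarrow> Y l \<in> borel_measurable P"
    using Y by (auto simp: indep_vars_def)
  have meas: "(\<lambda>\<omega>. \<lambda>l\<in>?I. Y l \<omega>) \<in> measurable P (PiM ?I (\<lambda>_. borel))"
    by (rule measurable_restrict) (rule rv)
  have "random_symmetric (PiM ?I (\<lambda>_. borel)) n (\<lambda>x. H_mat n k r p e x)"
    by (rule H_mat_random_symmetric) (rule measurable_component_singleton)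
  from mtrace_resolvent_bounded_measurable(1)[OF this z]
  have Fm: "?F \<in> borel_measurable (PiM ?I (\<lambda>_. borel))" by simp
  have "stieltjes (mean_esd P (\<lambda>\<omega>. H_mat n k r p e (\<lambda>l. Y l \<omega>))) z = (\<integral>\<omega>. ?F (\<lambda>l. Y l \<omega>) \<partial>P)"
    by (rule stieltjes_mean_esd[OF P H_mat_random_symmetric n z]) (rule rv)
  also have "\<dots> = (\<integral>\<omega>. ?F (\<lambda>l\<in>?I. Y l \<omega>) \<partial>P)"
    by (intro Bochner_Integration.integral_cong refl arg_cong[where f = "\<lambda>A. mtrace (resolvent A z) / of_nat n"] H_mat_cong)
       simp
  also have "\<dots> = (\<integral>x. ?F x \<partial>distr P (PiM ?I (\<lambda>_. borel)) (\<lambda>\<omega>. \<lambda>l\<in>?I. Y l \<omega>))"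
    by (rule integral_distr[OF meas Fm, symmetric])
  also have "distr P (PiM ?I (\<lambda>_. borel)) (\<lambda>\<omega>. \<lambda>l\<in>?I. Y l \<omega>) = PiM ?I (\<lambda>l. distr P borel (Y l))"
    using M by (intro iffD1[OF indep_vars_iff_distr_eq_PiM' Y] rv) auto
  also have "\<dots> = PiM ?I (edge_law P ?I Y)" by (rule PiM_cong) (auto simp: edge_law_def)
  finally show ?thesis .
qed

text \<open>
  The two vectors live on different probability spaces. Independence identifies each expectation with an
  integral over a product of one-dimensional laws, where the exchange can take place.
\<close>
proposition stieltjes_H_mat_swap:
  assumes P: "prob_space P" and X: "prob_space.indep_vars P (\<lambda>_. borel) X {1..num_edges n r k}"
    and P': "prob_space P'" and Z: "prob_space.indep_vars P' (\<lambda>_. borel) Z {1..num_edges n r k}"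
    and M: "num_edges n r k > 0" and n: "n > 0" and z: "Im z > 0" and s: "sigma_sq n k r p > 0"
    and e: "\<And>l. l \<in> {1..num_edges n r k} \<Longrightarrow> e l \<subseteq> {1..n}"
    and X2: "\<And>l. l \<in> {1..num_edges n r k} \<Longrightarrow> integrable P (\<lambda>\<omega>. (X l \<omega>)\<^sup>2)"
    and Z2: "\<And>l. l \<in> {1..num_edges n r k} \<Longrightarrow> integrable P' (\<lambda>\<omega>. (Z l \<omega>)\<^sup>2)"
    and m1: "\<And>l. l \<in> {1..num_edges n r k} \<Longrightarrow> (\<integral>\<omega>. X l \<omega> \<partial>P) = (\<integral>\<omega>. Z l \<omega> \<partial>P')"
    and m2: "\<And>l. l \<in> {1..num_edges n r k} \<Longrightarrow> (\<integral>\<omega>. (X l \<omega>)\<^sup>2 \<partial>P) = (\<integral>\<omega>. (Z l \<omega>)\<^sup>2 \<partial>P')"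
  defines "\<rho> \<equiv> \<lambda>l. swap_error n (Im z) (sqrt (real n * sigma_sq n k r p)) (card (e l))"
  shows "cmod (stieltjes (mean_esd P (\<lambda>\<omega>. H_mat n k r p e (\<lambda>l. X l \<omega>))) z
             - stieltjes (mean_esd P' (\<lambda>\<omega>. H_mat n k r p e (\<lambda>l. Z l \<omega>))) z)
    \<le> (\<Sum>l=1..num_edges n r k. (\<integral>\<omega>. \<rho> l (X l \<omega>) \<partial>P) + (\<integral>\<omega>. \<rho> l (Z l \<omega>) \<partial>P'))"
proof -
  let ?I = "{1..num_edges n r k}"
  let ?F = "\<lambda>x. mtrace (resolvent (H_mat n k r p e x) z) / of_nat n"
  define lawX where "lawX = edge_law P ?I X"
  define lawZ where "lawZ = edge_law P' ?I Z"
  have rvX: "\<And>l. l \<in> ?I \<Longrightarrow> X l \<in> borel_measurable P"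
    using X unfolding prob_space.indep_vars_def[OF P] by (elim conjE bspec)
  have rvZ: "\<And>l. l \<in> ?I \<Longrightarrow> Z l \<in> borel_measurable P'"
    using Z unfolding prob_space.indep_vars_def[OF P'] by (elim conjE bspec)
  have LX: "prob_space (lawX l)" "sets (lawX l) = sets borel" "integrable (lawX l) (\<lambda>x. x)"
    "integrable (lawX l) (\<lambda>x. x\<^sup>2)" for l
    by (unfold lawX_def) (rule edge_law_properties[OF P rvX X2]; assumption)+
  have LZ: "prob_space (lawZ l)" "sets (lawZ l) = sets borel" "integrable (lawZ l) (\<lambda>x. x)"
    "integrable (lawZ l) (\<lambda>x. x\<^sup>2)" for l
    by (unfold lawZ_def) (rule edge_law_properties[OF P' rvZ Z2]; assumption)+
  have law_integral: "(\<integral>x. f x \<partial>lawX l) = (if l \<in> ?I then \<integral>\<omega>. f (X l \<omega>) \<partial>P else f 0)"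
    "(\<integral>x. f x \<partial>lawZ l) = (if l \<in> ?I then \<integral>\<omega>. f (Z l \<omega>) \<partial>P' else f 0)"
    if "f \<in> borel_measurable borel" for f :: "real \<Rightarrow> real" and l
    unfolding lawX_def lawZ_def 
    by (simp_all only: edge_law_integral[OF rvX that] edge_law_integral[OF rvZ that])
  have meas: "(\<lambda>x::real. x) \<in> borel_measurable borel" "(\<lambda>x::real. x\<^sup>2) \<in> borel_measurable borel"
    by measurable
  have \<tau>: "sqrt (real n * sigma_sq n k r p) > 0" using n s by simp
  have "random_symmetric (PiM ?I (\<lambda>_. borel)) n (\<lambda>x. H_mat n k r p e x)"
    by (rule H_mat_random_symmetric) (rule measurable_component_singleton)
  note Fmb = mtrace_resolvent_bounded_measurable[OF this z]
  have "cmod ((\<integral>x. ?F x \<partial>PiM ?I lawX) - (\<integral>x. ?F x \<partial>PiM ?I lawZ))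
      \<le> (\<Sum>l\<in>?I. (\<integral>t. \<rho> l t \<partial>lawX l) + (\<integral>t. \<rho> l t \<partial>lawZ l))"
  proof (rule lindeberg_replacement[OF _ LX LZ, where K = "1 / Im z"])
    show "?F \<in> borel_measurable (PiM ?I (\<lambda>_. borel))" using Fmb(1) by simp
    show "cmod (?F x) \<le> 1 / Im z" for x
      using Fmb(2)[of x] n z by (simp add: norm_divide divide_simps mult.commute)
    show "(\<integral>x. x \<partial>lawX l) = (\<integral>x. x \<partial>lawZ l)" "(\<integral>x. x\<^sup>2 \<partial>lawX l) = (\<integral>x. x\<^sup>2 \<partial>lawZ l)" for l
      by (simp_all only: law_integral meas m1 m2 cong: if_cong)
    show "\<exists>c a b. \<forall>t. cmod (?F (x(l := t)) - (c + complex_of_real t * a + (complex_of_real t)\<^sup>2 * b)) \<le> \<rho> l t"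
      if "l \<in> ?I" for l x
      unfolding \<rho>_def using that e[OF that] z n by (rule resolvent_H_mat_taylor)
    show "integrable (lawX l) (\<rho> l)" "integrable (lawZ l) (\<rho> l)" for l
      unfolding \<rho>_def by (rule swap_error_integrable[OF z \<tau> LX(2,4)] swap_error_integrable[OF z \<tau> LZ(2,4)])+
  qed simp
  also have "\<dots> = (\<Sum>l=1..num_edges n r k. (\<integral>\<omega>. \<rho> l (X l \<omega>) \<partial>P) + (\<integral>\<omega>. \<rho> l (Z l \<omega>) \<partial>P'))"
    by (intro sum.cong refl) (simp only: law_integral \<rho>_def swap_error_measurable if_True)
  finally show ?thesis
    unfolding lawX_def lawZ_def H_mat_expectation_PiM[OF P X M n z] H_mat_expectation_PiM[OF P' Z M n z] .
qed

section \<open>Moments of the hyperedge variables and counting hyperedges\<close>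

text \<open>
  What the proof needs to know about a centred variable of a hyperedge of probability \<open>q\<close>. Bernoulli and
  Gaussian variables both qualify, so that everything after this point treats them alike.
\<close>
definition edge_moments :: "real \<Rightarrow> 'a measure \<Rightarrow> ('a \<Rightarrow> real) \<Rightarrow> bool" where
  "edge_moments q P Y \<longleftrightarrow> Y \<in> borel_measurable P \<and>
     integrable P (\<lambda>\<omega>. (Y \<omega>)\<^sup>2) \<and> integrable P (\<lambda>\<omega>. (Y \<omega>) ^ 4) \<and>
     (\<integral>\<omega>. Y \<omega> \<partial>P) = 0 \<and> (\<integral>\<omega>. (Y \<omega>)\<^sup>2 \<partial>P) = q * (1 - q) \<and> (\<integral>\<omega>. (Y \<omega>) ^ 4 \<partial>P) \<le> 3 * q"

lemma bernoulli_law_integral: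
  fixes g :: "real \<Rightarrow> real"
  assumes P: "prob_space P" and h: "h \<in> borel_measurable P" "distr P borel h = bernoulli_law q"
    and q: "0 \<le> q" "q \<le> 1" and g: "g \<in> borel_measurable borel"
  shows "integrable P (\<lambda>\<omega>. g (h \<omega>))" "(\<integral>\<omega>. g (h \<omega>) \<partial>P) = g 1 * q + g 0 * (1 - q)"
proof -
  have "integrable (bernoulli_law q) g"
    unfolding bernoulli_law_def using g
    by (subst integrable_distr_eq) (auto intro: integrable_measure_pmf_finite)
  then show "integrable P (\<lambda>\<omega>. g (h \<omega>))"
    unfolding h(2)[symmetric] integrable_distr_eq[OF h(1) g] .
  have "(\<integral>\<omega>. g (h \<omega>) \<partial>P) = (\<integral>x. g x \<partial>bernoulli_law q)"
    unfolding h(2)[symmetric] using integral_distr[OF h(1) g] by simp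
  also have "\<dots> = g 1 * q + g 0 * (1 - q)"
    unfolding bernoulli_law_def using g q by (subst integral_distr) auto
  finally show "(\<integral>\<omega>. g (h \<omega>) \<partial>P) = g 1 * q + g 0 * (1 - q)" .
qed

lemma bernoulli_edge_moments:
  assumes P: "prob_space P" and h: "h l \<in> borel_measurable P" "distr P borel (h l) = bernoulli_law q"
    and q: "0 \<le> q" "q \<le> 1"
  shows "edge_moments q P (centered P h l)"
proof -
  note int = bernoulli_law_integral[OF P h q]
  have "(\<integral>\<omega>. h l \<omega> \<partial>P) = q" using int(2)[of "\<lambda>x. x"] by simp
  then have X: "centered P h l = (\<lambda>\<omega>. h l \<omega> - q)" by (simp add: centered_def fun_eq_iff)
  \<comment> \<open>The left-hand side is the fourth central moment: the centred variable takes the values $1-q$ and $-q$ with probabilities $q$ and $1-q$.\<close>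
  have "(1 - q) ^ 4 * q + q ^ 4 * (1 - q) \<le> 1 * q + q * 1"
  proof (intro add_mono mult_mono)
    show "(1 - q) ^ 4 \<le> 1" using q by (intro power_le_one) auto
    have "q ^ 4 \<le> q ^ 1" using q by (intro power_decreasing) auto
    then show "q ^ 4 \<le> q" by simp
  qed (use q in auto)
  then have fourth: "(1 - q) ^ 4 * q + q ^ 4 * (1 - q) \<le> 3 * q" using q by simp
  have i1: "(\<integral>\<omega>. h l \<omega> - q \<partial>P) = 0"
    using int(2)[of "\<lambda>x. x - q"] by (simp add: algebra_simps)
  have i2: "(\<integral>\<omega>. (h l \<omega> - q)\<^sup>2 \<partial>P) = q * (1 - q)"
    using int(2)[of "\<lambda>x. (x - q)\<^sup>2"] by (simp add: power2_eq_square algebra_simps)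
  have i4: "(\<integral>\<omega>. (h l \<omega> - q) ^ 4 \<partial>P) = (1 - q) ^ 4 * q + q ^ 4 * (1 - q)"
    using int(2)[of "\<lambda>x. (x - q) ^ 4"] by simp
  show ?thesis
    unfolding edge_moments_def X i1 i2 i4
    using h(1) fourth int(1)[of "\<lambda>x. (x - q)\<^sup>2"] int(1)[of "\<lambda>x. (x - q) ^ 4"] by simp
qed

lemma gaussian_law_moments:
  assumes v: "0 \<le> v"
  shows "integrable (gaussian_law v) (\<lambda>x. x ^ m)"
    "(\<integral>x. x \<partial>gaussian_law v) = 0" "(\<integral>x. x\<^sup>2 \<partial>gaussian_law v) = v" "(\<integral>x. x ^ 4 \<partial>gaussian_law v) = 3 * v\<^sup>2"
proof -
  have "integrable (gaussian_law v) (\<lambda>x. x ^ m) \<and>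
    (\<integral>x. x \<partial>gaussian_law v) = 0 \<and> (\<integral>x. x\<^sup>2 \<partial>gaussian_law v) = v \<and> (\<integral>x. x ^ 4 \<partial>gaussian_law v) = 3 * v\<^sup>2"
  proof (cases "v = 0")
    case True
    interpret prob_space "return borel (0::real)" by (rule prob_space_return) simp
    have "integrable (return borel (0::real)) (\<lambda>x. x ^ m)"
      by (rule integrable_const_bound[of _ "\<bar>0 ^ m\<bar>"]) (auto simp: AE_return)
    then show ?thesis using True by (simp add: gaussian_law_def integral_return)
  next
    case False
    then have s: "sqrt v > 0" using v by simp
    have eq: "gaussian_law v = density lborel (\<lambda>x. ennreal (normal_density 0 (sqrt v) x))"
      using False by (simp add: gaussian_law_def)
    have int: "integrable (gaussian_law v) g \<longleftrightarrow> integrable lborel (\<lambda>x. normal_density 0 (sqrt v) x * g x)"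
      "(\<integral>x. g x \<partial>gaussian_law v) = (\<integral>x. normal_density 0 (sqrt v) x * g x \<partial>lborel)"
      if "g \<in> borel_measurable borel" for g :: "real \<Rightarrow> real"
      unfolding eq using that by (simp_all add: integrable_density integral_density)
    have "(\<lambda>x::real. x ^ m) \<in> borel_measurable borel" by simp
    from int(1)[OF this] have "integrable (gaussian_law v) (\<lambda>x. x ^ m)"
      using integrable_normal_moment[OF s, of 0 m] by simp
    moreover have "(\<integral>x. x \<partial>gaussian_law v) = 0"
      using integral_normal_moment_odd[OF s, of 0 0] by (simp add: int)
    moreover have "(\<integral>x. x\<^sup>2 \<partial>gaussian_law v) = v"
      using integral_normal_moment_even[OF s, of 0 1] v by (simp add: int)
    moreover have "(\<integral>x. x ^ 4 \<partial>gaussian_law v) = 3 * v\<^sup>2"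
      using integral_normal_moment_even[OF s, of 0 2] v
      by (simp add: int fact_numeral power_divide)
    ultimately show ?thesis by simp
  qed
  then show "integrable (gaussian_law v) (\<lambda>x. x ^ m)"
    "(\<integral>x. x \<partial>gaussian_law v) = 0" "(\<integral>x. x\<^sup>2 \<partial>gaussian_law v) = v" "(\<integral>x. x ^ 4 \<partial>gaussian_law v) = 3 * v\<^sup>2"
    by auto
qed

lemma gaussian_edge_moments:
  assumes Z: "Z \<in> borel_measurable P" "distr P borel Z = gaussian_law (q * (1 - q))"
    and q: "0 \<le> q" "q \<le> 1"
  shows "edge_moments q P Z"
proof -
  let ?v = "q * (1 - q)"
  have v: "0 \<le> ?v" using q by simp
  note mom = gaussian_law_moments[OF v]
  have int: "integrable P (\<lambda>\<omega>. g (Z \<omega>)) \<longleftrightarrow> integrable (gaussian_law ?v) g"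
    "(\<integral>\<omega>. g (Z \<omega>) \<partial>P) = (\<integral>x. g x \<partial>gaussian_law ?v)"
    if "g \<in> borel_measurable borel" for g :: "real \<Rightarrow> real"
    unfolding Z(2)[symmetric] integrable_distr_eq[OF Z(1) that] integral_distr[OF Z(1) that] by simp_all
  have "?v \<le> q * 1" "?v \<le> 1 * 1" using q by (intro mult_left_mono mult_mono; simp)+
  then have "?v * ?v \<le> q * 1" using v q by (intro mult_mono) auto
  then have "3 * ?v\<^sup>2 \<le> 3 * q" by (simp add: power2_eq_square)
  moreover have "(\<integral>\<omega>. Z \<omega> \<partial>P) = 0" using int(2)[of "\<lambda>x. x"] mom(2) by simp
  moreover have "(\<integral>\<omega>. (Z \<omega>)\<^sup>2 \<partial>P) = ?v" using int(2)[of "\<lambda>x. x\<^sup>2"] mom(3) by simp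
  moreover have "(\<integral>\<omega>. (Z \<omega>) ^ 4 \<partial>P) = 3 * ?v\<^sup>2" using int(2)[of "\<lambda>x. x ^ 4"] mom(4) by simp
  moreover have "integrable P (\<lambda>\<omega>. (Z \<omega>)\<^sup>2)" "integrable P (\<lambda>\<omega>. (Z \<omega>) ^ 4)"
    using int(1)[of "\<lambda>x. x\<^sup>2"] int(1)[of "\<lambda>x. x ^ 4"] mom(1) by simp_all
  ultimately show ?thesis
    unfolding edge_moments_def using Z(1) by simp
qed

lemma sum_edge_blocks:
  fixes f :: "nat \<Rightarrow> real"
  shows "(\<Sum>l=1..num_edges n r k. f l) = (\<Sum>i=1..k. \<Sum>l\<in>edge_block n r i. f l)"
proof (induction k)
  case (Suc k)
  have le: "num_edges n r k \<le> num_edges n r (Suc k)" by (simp add: num_edges_def)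
  have "{1..num_edges n r (Suc k)} = {1..num_edges n r k} \<union> edge_block n r (Suc k)"
    using le by (auto simp: edge_block_def)
  moreover have "{1..num_edges n r k} \<inter> edge_block n r (Suc k) = {}"
    by (auto simp: edge_block_def)
  ultimately have "(\<Sum>l=1..num_edges n r (Suc k). f l)
      = (\<Sum>l=1..num_edges n r k. f l) + (\<Sum>l\<in>edge_block n r (Suc k). f l)"
    by (simp add: sum.union_disjoint edge_block_def)
  then show ?case using Suc by simp
qed (simp add: num_edges_def)

lemma edge_block_cover:
  assumes "l \<in> {1..num_edges n r k}"
  shows "\<exists>i\<in>{1..k}. l \<in> edge_block n r i"
  using assms
proof (induction k)
  case (Suc k)
  show ?case
  proof (cases "l \<le> num_edges n r k")
    case True
    then obtain i where "i \<in> {1..k}" "l \<in> edge_block n r i" using Suc by auto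
    then show ?thesis by (intro bexI[of _ i]) auto
  next
    case False
    then show ?thesis using Suc.prems by (intro bexI[of _ "Suc k"]) (auto simp: edge_block_def)
  qed
qed (simp add: num_edges_def)

lemma edge_block_subset: 
  assumes "i \<in> {1..k}"
  shows "edge_block n r i \<subseteq> {1..num_edges n r k}"
proof -
  have "num_edges n r i \<le> num_edges n r k"
    unfolding num_edges_def by (rule sum_mono2) (use assms in auto)
  then show ?thesis by (auto simp: edge_block_def)
qed

lemma card_edge_block: "i \<ge> 1 \<Longrightarrow> card (edge_block n r i) = n choose r i"
  by (cases i) (simp_all add: edge_block_def num_edges_def)

lemma edge_properties:
  assumes "edge_enumeration n k r e" "i \<in> {1..k}" "l \<in> edge_block n r i"
  shows "e l \<subseteq> {1..n}" "card (e l) = r i"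
  using assms unfolding edge_enumeration_def bij_betw_def by blast+

lemma sum_edge_blocks_const:
  fixes f :: "nat \<Rightarrow> real"
  assumes "\<And>i l. i \<in> {1..k} \<Longrightarrow> l \<in> edge_block n r i \<Longrightarrow> f l \<le> g i"
  shows "(\<Sum>l=1..num_edges n r k. f l) \<le> (\<Sum>i=1..k. real (n choose r i) * g i)"
  unfolding sum_edge_blocks
proof (rule sum_mono)
  fix i assume i: "i \<in> {1..k}"
  have "(\<Sum>l\<in>edge_block n r i. f l) \<le> of_nat (card (edge_block n r i)) * g i"
    by (rule sum_bounded_above) (use assms i in auto)
  then show "(\<Sum>l\<in>edge_block n r i. f l) \<le> real (n choose r i) * g i"
    using i by (simp add: card_edge_block)
qed

text \<open>
  Links the number of hyperedges, over which variances are summed, with the number of hyperedges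
  through two given vertices, which enters $\sigma^2$.
\<close>
lemma binomial_two_absorption:
  assumes "2 \<le> r" "r \<le> n"
  shows "real r * (real r - 1) * real (n choose r) = real n * (real n - 1) * real ((n - 2) choose (r - 2))"
proof -
  have "r * (n choose r) = n * ((n - 1) choose (r - 1))"
    using assms by (intro times_binomial_minus1_eq) auto
  then have a: "real r * real (n choose r) = real n * real ((n - 1) choose (r - 1))"
    by (metis of_nat_mult)
  have "(r - 1) * ((n - 1) choose (r - 1)) = (n - 1) * ((n - 1 - 1) choose (r - 1 - 1))"
    using assms by (intro times_binomial_minus1_eq) auto
  then have "real (r - 1) * real ((n - 1) choose (r - 1)) = real (n - 1) * real ((n - 2) choose (r - 2))"
    by (metis of_nat_mult diff_diff_left one_add_one)
  then have b: "(real r - 1) * real ((n - 1) choose (r - 1)) = (real n - 1) * real ((n - 2) choose (r - 2))"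
    using assms by (simp add: of_nat_diff)
  show ?thesis using a b by (metis mult.assoc mult.left_commute)
qed

section \<open>Quantitative comparison for a fixed hypergraph\<close>

definition edge_vector :: "nat \<Rightarrow> nat \<Rightarrow> (nat \<Rightarrow> nat) \<Rightarrow> (nat \<Rightarrow> real) \<Rightarrow> 'a measure \<Rightarrow> (nat \<Rightarrow> 'a \<Rightarrow> real) \<Rightarrow> bool" where
  "edge_vector n k r p P Y \<longleftrightarrow> prob_space P \<and>
     prob_space.indep_vars P (\<lambda>_. borel) Y {1..num_edges n r k} \<and>
     (\<forall>i\<in>{1..k}. \<forall>l\<in>edge_block n r i. edge_moments (p i) P (Y l))"

text \<open>
  The quantity bounded by the Pastur-type condition.
\<close>
definition truncated_variance :: "nat \<Rightarrow> nat \<Rightarrow> (nat \<Rightarrow> nat) \<Rightarrow> 'a measure \<Rightarrow> (nat \<Rightarrow> 'a \<Rightarrow> real) \<Rightarrow> real \<Rightarrow> real" where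
  "truncated_variance n k r P Y T = (\<Sum>l=1..num_edges n r k.
     \<integral>\<omega>. (Y l \<omega>)\<^sup>2 * indicator {\<omega>'. \<bar>Y l \<omega>'\<bar> > T} \<omega> \<partial>P)"

lemma edge_moments_truncated_integrable:
  assumes "edge_moments q P Y"
  shows "integrable P (\<lambda>\<omega>. (Y \<omega>)\<^sup>2 * indicator {\<omega>'. \<bar>Y \<omega>'\<bar> > T} \<omega>)"
proof (rule Bochner_Integration.integrable_bound)
  show "integrable P (\<lambda>\<omega>. (Y \<omega>)\<^sup>2)" using assms by (simp add: edge_moments_def)
  have [measurable]: "Y \<in> borel_measurable P" using assms by (simp add: edge_moments_def)
  have "(\<lambda>\<omega>. (Y \<omega>)\<^sup>2 * indicator {y. \<bar>y\<bar> > T} (Y \<omega>)) \<in> borel_measurable P" by measurable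
  then show "(\<lambda>\<omega>. (Y \<omega>)\<^sup>2 * indicator {\<omega>'. \<bar>Y \<omega>'\<bar> > T} \<omega> :: real) \<in> borel_measurable P"
    by (simp add: indicator_def)
qed (auto simp: indicator_def)

text \<open>
  The model for one fixed number of vertices.
\<close>
locale hypergraph =
  fixes n k :: nat and r :: "nat \<Rightarrow> nat" and p :: "nat \<Rightarrow> real" and e :: "nat \<Rightarrow> nat set"
  assumes r_range: "\<And>i. i \<in> {1..k} \<Longrightarrow> 2 \<le> r i \<and> r i \<le> n"
    and p_range: "\<And>i. i \<in> {1..k} \<Longrightarrow> 0 \<le> p i \<and> p i \<le> 1"
    and edges: "edge_enumeration n k r e"
    and sigma_pos: "sigma_sq n k r p > 0"
begin

abbreviation "S \<equiv> sigma_sq n k r p"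
abbreviation "\<tau> \<equiv> sqrt (real n * S)"
abbreviation "R \<equiv> real (r_max k r)"

lemma k_pos: "1 \<in> {1..k}"
  using sigma_pos by (cases k) (auto simp: sigma_sq_def)

lemma n_pos: "n > 0"
  using r_range[OF k_pos] by simp

lemma num_edges_pos: "num_edges n r k > 0"
proof -
  have "n choose r 1 \<le> num_edges n r k"
    unfolding num_edges_def by (rule member_le_sum) (use k_pos in auto)
  moreover have "n choose r 1 > 0" using r_range[OF k_pos] by (simp add: zero_less_binomial_iff)
  ultimately show ?thesis by (rule less_le_trans[rotated])
qed

lemma \<tau>_pos: "\<tau> > 0" and \<tau>_sq: "\<tau>\<^sup>2 = real n * S"
  using sigma_pos n_pos by simp_all

lemma sigma_sq_i_nonneg: "i \<in> {1..k} \<Longrightarrow> 0 \<le> sigma_sq_i p i"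
  using p_range by (simp add: sigma_sq_i_def)

lemma r_le_max: "i \<in> {1..k} \<Longrightarrow> real (r i) \<le> R"
  unfolding r_max_def by (simp add: Max_ge)

lemma R_ge_2: "2 \<le> R"
proof -
  have "2 \<le> real (r 1)" using r_range[OF k_pos] by simp
  then show ?thesis using r_le_max[OF k_pos] by linarith
qed

lemma edge: "i \<in> {1..k} \<Longrightarrow> l \<in> edge_block n r i \<Longrightarrow> e l \<subseteq> {1..n} \<and> card (e l) = r i"
  using edge_properties[OF edges] by blast

text \<open>
  The quadratic bound is used where $|Y| > T$ and the cubic bound, in the form $|y|^3 \le T y^2$,
  elsewhere. In the first term the size of the hyperedge is replaced by the maximal one, to match the
  Pastur-type condition; in the second term the power $r_i^6$ is kept, because two of its factors are
  needed to compare $\binom{n}{r_i}$ with $\binom{n-2}{r_i-2}$.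
\<close>
lemma swap_error_expectation:
  assumes i: "i \<in> {1..k}" and l: "l \<in> edge_block n r i" and Y: "edge_moments (p i) P Y"
    and v: "v > 0" and T: "T > 0"
  shows "(\<integral>\<omega>. swap_error n v \<tau> (card (e l)) (Y \<omega>) \<partial>P)
    \<le> 2 * R ^ 4 / (v ^ 3 * \<tau>\<^sup>2 * real n) * (\<integral>\<omega>. (Y \<omega>)\<^sup>2 * indicator {\<omega>'. \<bar>Y \<omega>'\<bar> > T} \<omega> \<partial>P)
      + T / (v ^ 4 * \<tau> ^ 3 * real n) * (real (r i) ^ 6 * sigma_sq_i p i)"
proof -
  let ?s = "real (r i)"
  let ?a = "2 * R ^ 4 / (v ^ 3 * \<tau>\<^sup>2 * real n)" and ?b = "T / (v ^ 4 * \<tau> ^ 3 * real n) * ?s ^ 6"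
  let ?g = "\<lambda>\<omega>. (Y \<omega>)\<^sup>2 * indicator {\<omega>'. \<bar>Y \<omega>'\<bar> > T} \<omega>"
  have i1: "integrable P ?g" by (rule edge_moments_truncated_integrable[OF Y])
  have i2: "integrable P (\<lambda>\<omega>. (Y \<omega>)\<^sup>2)" and m2: "(\<integral>\<omega>. (Y \<omega>)\<^sup>2 \<partial>P) = sigma_sq_i p i"
    using Y by (simp_all add: edge_moments_def sigma_sq_i_def)
  have b_nonneg: "0 \<le> ?b" using v T \<tau>_pos by simp
  have pointwise: "swap_error n v \<tau> (card (e l)) y
      \<le> ?a * (y\<^sup>2 * indicator {y. \<bar>y\<bar> > T} y) + ?b * y\<^sup>2" for y
  proof (cases "\<bar>y\<bar> > T")
    case True
    have "swap_error n v \<tau> (r i) y \<le> 2 * ?s ^ 4 / (v ^ 3 * \<tau>\<^sup>2 * real n) * y\<^sup>2"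
      by (rule swap_error_bounds(2)[OF v \<tau>_pos])
    also have "\<dots> \<le> ?a * y\<^sup>2"
      using v r_le_max[OF i] sigma_pos
      by (intro mult_right_mono divide_right_mono mult_left_mono power_mono) auto
    finally have "swap_error n v \<tau> (r i) y \<le> ?a * y\<^sup>2 + ?b * y\<^sup>2"
      using mult_nonneg_nonneg[OF b_nonneg, of "y\<^sup>2"] by simp
    then show ?thesis using True edge[OF i l] by simp
  next
    case False
    have "swap_error n v \<tau> (r i) y \<le> ?s ^ 6 / (v ^ 4 * \<tau> ^ 3 * real n) * \<bar>y\<bar> ^ 3"
      by (rule swap_error_bounds(3)[OF v \<tau>_pos])
    also have "\<bar>y\<bar> ^ 3 = \<bar>y\<bar> * y\<^sup>2"
      by (simp add: power3_eq_cube power2_eq_square)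
    also have "?s ^ 6 / (v ^ 4 * \<tau> ^ 3 * real n) * (\<bar>y\<bar> * y\<^sup>2) \<le> ?s ^ 6 / (v ^ 4 * \<tau> ^ 3 * real n) * (T * y\<^sup>2)"
      using False v sigma_pos by (intro mult_left_mono mult_right_mono) auto
    also have "\<dots> = ?b * y\<^sup>2" by simp
    finally show ?thesis using False edge[OF i l] by simp
  qed
  have "(\<integral>\<omega>. swap_error n v \<tau> (card (e l)) (Y \<omega>) \<partial>P) \<le> (\<integral>\<omega>. ?a * ?g \<omega> + ?b * (Y \<omega>)\<^sup>2 \<partial>P)"
  proof (rule Bochner_Integration.integral_mono')
    show "integrable P (\<lambda>\<omega>. ?a * ?g \<omega> + ?b * (Y \<omega>)\<^sup>2)" using i1 i2 by simp
    fix \<omega>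
    show "swap_error n v \<tau> (card (e l)) (Y \<omega>) \<le> ?a * ?g \<omega> + ?b * (Y \<omega>)\<^sup>2"
      using pointwise[of "Y \<omega>"] by (simp add: indicator_def)
    show "0 \<le> ?a * ?g \<omega> + ?b * (Y \<omega>)\<^sup>2"
      using T v sigma_pos by (intro add_nonneg_nonneg mult_nonneg_nonneg) auto
  qed
  also have "\<dots> = ?a * (\<integral>\<omega>. ?g \<omega> \<partial>P) + ?b * sigma_sq_i p i"
    using i1 i2 by (simp add: m2)
  finally show ?thesis by (simp add: mult.assoc)
qed

text \<open>
  Two of the six factors $r$ are spent on $\binom nr r^2 \le 2 n^2 \binom{n-2}{r-2}$, which holds since
  $r^2 \le 2 r (r-1)$ for $r \ge 2$.
\<close>
lemma sixth_power_weighted_variance: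
  "(\<Sum>i=1..k. real (n choose r i) * (real (r i) ^ 6 * sigma_sq_i p i)) \<le> 2 * (real n)\<^sup>2 * R ^ 4 * S"
proof -
  have "real (n choose r i) * (real (r i) ^ 6 * sigma_sq_i p i)
      \<le> 2 * (real n)\<^sup>2 * R ^ 4 * (real ((n - 2) choose (r i - 2)) * sigma_sq_i p i)" if i: "i \<in> {1..k}" for i
  proof -
    let ?r = "real (r i)" and ?C = "real (n choose r i)" and ?D = "real ((n - 2) choose (r i - 2))"
    have r2: "2 \<le> ?r" using r_range[OF i] by simp
    have "?C * ?r\<^sup>2 \<le> ?C * (2 * (?r * (?r - 1)))"
      using r2 by (intro mult_left_mono) (auto simp: power2_eq_square)
    also have "\<dots> = 2 * (real n * (real n - 1) * ?D)"
      using r_range[OF i] by (subst binomial_two_absorption[symmetric]) (auto simp: mult_ac)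
    also have "\<dots> \<le> 2 * (real n * real n * ?D)"
      by (intro mult_left_mono mult_right_mono) auto
    finally have "?C * ?r\<^sup>2 \<le> 2 * (real n)\<^sup>2 * ?D" by (simp add: power2_eq_square)
    moreover have "?r ^ 4 * sigma_sq_i p i \<le> R ^ 4 * sigma_sq_i p i"
      using r_le_max[OF i] sigma_sq_i_nonneg[OF i] by (intro mult_right_mono power_mono) auto
    ultimately have "(?C * ?r\<^sup>2) * (?r ^ 4 * sigma_sq_i p i) \<le> (2 * (real n)\<^sup>2 * ?D) * (R ^ 4 * sigma_sq_i p i)"
      by (rule mult_mono) (use sigma_sq_i_nonneg[OF i] in auto)
    moreover have "?r\<^sup>2 * ?r ^ 4 = ?r ^ 6" by (simp flip: power_add)
    ultimately show ?thesis by (simp add: mult_ac)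
  qed
  then show ?thesis
    unfolding sigma_sq_def sum_distrib_left by (intro sum_mono) auto
qed

text \<open>
  Inserting the truncation level $T = \epsilon \tau / (r_{\max}^6 \xi)$ into the cubic part leaves
  $2\epsilon / (v^4 r_{\max}^2 \xi)$; the assumption on \<open>xi\<close> bounds this uniformly.
\<close>
lemma swap_error_sum:
  assumes Y: "edge_vector n k r p P Y" and v: "v > 0" and \<epsilon>: "\<epsilon> > 0"
    and \<xi>: "1 \<le> R\<^sup>2 * xi k r w"
    and trunc: "truncated_variance n k r P Y (\<epsilon> * K_trunc n k r p w) \<le> \<epsilon> * ((real n)\<^sup>2 * S / R ^ 4)"
  shows "(\<Sum>l=1..num_edges n r k. \<integral>\<omega>. swap_error n v \<tau> (card (e l)) (Y l \<omega>) \<partial>P) \<le> \<epsilon> * (2 / v ^ 3 + 2 / v ^ 4)"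
proof -
  let ?x = "xi k r w"
  define T where "T = \<epsilon> * K_trunc n k r p w"
  have R: "R > 0" using R_ge_2 by simp
  have x: "?x > 0" using \<xi> R by (metis less_le_not_le linorder_not_le mult_le_0_iff not_one_le_zero order_trans zero_le_power2)
  have T: "T = \<epsilon> * \<tau> / (R ^ 6 * ?x)" by (simp add: T_def K_trunc_def)
  have T0: "T > 0" unfolding T using \<epsilon> \<tau>_pos R x by simp
  let ?A = "2 * R ^ 4 / (v ^ 3 * \<tau>\<^sup>2 * real n)" and ?B = "T / (v ^ 4 * \<tau> ^ 3 * real n)"
  let ?tv = "\<lambda>l. \<integral>\<omega>. (Y l \<omega>)\<^sup>2 * indicator {\<omega>'. \<bar>Y l \<omega>'\<bar> > T} \<omega> \<partial>P"
  let ?sw = "\<lambda>l. \<integral>\<omega>. swap_error n v \<tau> (card (e l)) (Y l \<omega>) \<partial>P"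
  have "?sw l - ?A * ?tv l \<le> ?B * (real (r i) ^ 6 * sigma_sq_i p i)"
    if "i \<in> {1..k}" "l \<in> edge_block n r i" for i l
    using swap_error_expectation[OF that _ v T0, of P "Y l"] Y that by (simp add: edge_vector_def)
  from sum_edge_blocks_const[of k n r "\<lambda>l. ?sw l - ?A * ?tv l", OF this]
  have "(\<Sum>l=1..num_edges n r k. ?sw l) - ?A * truncated_variance n k r P Y T
      \<le> (\<Sum>i=1..k. real (n choose r i) * (?B * (real (r i) ^ 6 * sigma_sq_i p i)))"
    by (simp add: sum_subtractf truncated_variance_def sum_distrib_left)
  also have "\<dots> = ?B * (\<Sum>i=1..k. real (n choose r i) * (real (r i) ^ 6 * sigma_sq_i p i))"
    unfolding sum_distrib_left by (intro sum.cong refl mult.left_commute)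
  also have "\<dots> \<le> ?B * (2 * (real n)\<^sup>2 * R ^ 4 * S)"
    using T0 v \<tau>_pos by (intro mult_left_mono sixth_power_weighted_variance) simp
  also have "\<dots> = 2 * \<epsilon> / v ^ 4 / (R\<^sup>2 * ?x)"
  proof -
    have "?B * (2 * (real n)\<^sup>2 * R ^ 4 * S) = 2 * R ^ 4 * (T / (v ^ 4 * \<tau> ^ 3)) * (real n * S)"
      using n_pos by (simp add: power2_eq_square)
    also have "\<dots> = 2 * R ^ 4 * (\<epsilon> * \<tau> / (R ^ 6 * ?x) / (v ^ 4 * \<tau> ^ 3)) * \<tau>\<^sup>2"
      unfolding T \<tau>_sq ..
    also have "\<dots> = 2 * \<epsilon> / v ^ 4 / (R\<^sup>2 * ?x)"
    proof -
      \<comment> \<open>With \<open>\<tau>\<close> as a variable, since simplification would rewrite the square of the root but not its cube.\<close>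
      have cancel: "2 * b ^ 4 * (\<epsilon> * t / (b ^ 6 * y) / (u * t ^ 3)) * t\<^sup>2 = 2 * \<epsilon> / u / (b\<^sup>2 * y)"
        if "b > 0" "t > 0" "y > 0" "u > 0" for b t y u :: real
        using that by (simp add: divide_simps) (simp add: eval_nat_numeral)
      show ?thesis by (rule cancel[OF R \<tau>_pos x]) (use v in simp)
    qed
    finally show ?thesis .
  qed
  also have "\<dots> \<le> 2 * \<epsilon> / v ^ 4"
    using \<xi> \<epsilon> v divide_left_mono[OF \<xi>, of "2 * \<epsilon> / v ^ 4"] by simp
  finally have "(\<Sum>l=1..num_edges n r k. ?sw l) \<le> ?A * truncated_variance n k r P Y T + 2 * \<epsilon> / v ^ 4" by simp
  also have "?A * truncated_variance n k r P Y T \<le> ?A * (\<epsilon> * ((real n)\<^sup>2 * S / R ^ 4))"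
    using trunc v R sigma_pos unfolding T_def by (intro mult_left_mono) auto
  also have "\<dots> = 2 * \<epsilon> / v ^ 3"
    unfolding \<tau>_sq using R v n_pos sigma_pos by (simp add: divide_simps power2_eq_square)
  finally show ?thesis by (simp add: distrib_left mult.commute)
qed

lemma stieltjes_distance:
  assumes X: "edge_vector n k r p P X" and Z: "edge_vector n k r p P' Z" and z: "Im z > 0" and \<epsilon>: "\<epsilon> > 0"
    and \<xi>: "1 \<le> R\<^sup>2 * xi k r w"
    and truncX: "truncated_variance n k r P X (\<epsilon> * K_trunc n k r p w) \<le> \<epsilon> * ((real n)\<^sup>2 * S / R ^ 4)"
    and truncZ: "truncated_variance n k r P' Z (\<epsilon> * K_trunc n k r p w) \<le> \<epsilon> * ((real n)\<^sup>2 * S / R ^ 4)"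
  shows "cmod (stieltjes (mean_esd P (\<lambda>\<omega>. H_mat n k r p e (\<lambda>l. X l \<omega>))) z
             - stieltjes (mean_esd P' (\<lambda>\<omega>. H_mat n k r p e (\<lambda>l. Z l \<omega>))) z)
      \<le> \<epsilon> * (4 / Im z ^ 3 + 4 / Im z ^ 4)"
proof -
  have mom: "edge_moments (p i) P (X l)" "edge_moments (p i) P' (Z l)"
    if "i \<in> {1..k}" "l \<in> edge_block n r i" for i l
    using X Z that by (auto simp: edge_vector_def)
  have "cmod (stieltjes (mean_esd P (\<lambda>\<omega>. H_mat n k r p e (\<lambda>l. X l \<omega>))) z
             - stieltjes (mean_esd P' (\<lambda>\<omega>. H_mat n k r p e (\<lambda>l. Z l \<omega>))) z)
      \<le> (\<Sum>l=1..num_edges n r k. (\<integral>\<omega>. swap_error n (Im z) \<tau> (card (e l)) (X l \<omega>) \<partial>P)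
           + (\<integral>\<omega>. swap_error n (Im z) \<tau> (card (e l)) (Z l \<omega>) \<partial>P'))"
  proof (rule stieltjes_H_mat_swap)
    show "prob_space P" "prob_space.indep_vars P (\<lambda>_. borel) X {1..num_edges n r k}"
      "prob_space P'" "prob_space.indep_vars P' (\<lambda>_. borel) Z {1..num_edges n r k}"
      using X Z by (simp_all add: edge_vector_def)
    fix l assume "l \<in> {1..num_edges n r k}"
    then obtain i where i: "i \<in> {1..k}" "l \<in> edge_block n r i" using edge_block_cover by blast
    show "e l \<subseteq> {1..n}" using edge[OF i] by simp
    show "integrable P (\<lambda>\<omega>. (X l \<omega>)\<^sup>2)" "integrable P' (\<lambda>\<omega>. (Z l \<omega>)\<^sup>2)"
      "(\<integral>\<omega>. X l \<omega> \<partial>P) = (\<integral>\<omega>. Z l \<omega> \<partial>P')" "(\<integral>\<omega>. (X l \<omega>)\<^sup>2 \<partial>P) = (\<integral>\<omega>. (Z l \<omega>)\<^sup>2 \<partial>P')"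
      using mom[OF i] by (simp_all add: edge_moments_def)
  qed (rule num_edges_pos n_pos z sigma_pos)+
  also have "\<dots> \<le> \<epsilon> * (2 / Im z ^ 3 + 2 / Im z ^ 4) + \<epsilon> * (2 / Im z ^ 3 + 2 / Im z ^ 4)"
    unfolding sum.distrib
    by (intro add_mono swap_error_sum[OF X z \<epsilon> \<xi> truncX] swap_error_sum[OF Z z \<epsilon> \<xi> truncZ])
  finally show ?thesis by (simp add: algebra_simps)
qed

text \<open>
  On the event $|Y| > T$ one has $Y^2 \le Y^4 / T^2$.
\<close>
lemma truncated_variance_fourth_moment:
  assumes Y: "edge_vector n k r p P Y" and T: "T > 0"
  shows "truncated_variance n k r P Y T \<le> 3 * real n / T\<^sup>2 * (\<Sum>i=1..k. avg_degree n r p i / real (r i))"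
proof -
  have "(\<integral>\<omega>. (Y l \<omega>)\<^sup>2 * indicator {\<omega>'. \<bar>Y l \<omega>'\<bar> > T} \<omega> \<partial>P) \<le> 3 * p i / T\<^sup>2"
    if i: "i \<in> {1..k}" and l: "l \<in> edge_block n r i" for i l
  proof -
    have mom: "edge_moments (p i) P (Y l)" using Y i l by (auto simp: edge_vector_def)
    have "(\<integral>\<omega>. (Y l \<omega>)\<^sup>2 * indicator {\<omega>'. \<bar>Y l \<omega>'\<bar> > T} \<omega> \<partial>P) \<le> (\<integral>\<omega>. (Y l \<omega>) ^ 4 / T\<^sup>2 \<partial>P)"
    proof (rule Bochner_Integration.integral_mono')
      show "integrable P (\<lambda>\<omega>. (Y l \<omega>) ^ 4 / T\<^sup>2)" using mom by (simp add: edge_moments_def)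
      fix \<omega>
      have "y\<^sup>2 * T\<^sup>2 \<le> y ^ 4" if "\<bar>y\<bar> > T" for y
      proof -
        have "T\<^sup>2 \<le> y\<^sup>2" using that T by (simp add: abs_le_square_iff[symmetric])
        then have "y\<^sup>2 * T\<^sup>2 \<le> y\<^sup>2 * y\<^sup>2" by (intro mult_left_mono) auto
        then show ?thesis by (simp flip: power_add)
      qed
      then show "(Y l \<omega>)\<^sup>2 * indicator {\<omega>'. \<bar>Y l \<omega>'\<bar> > T} \<omega> \<le> (Y l \<omega>) ^ 4 / T\<^sup>2"
        using T by (auto simp: indicator_def le_divide_eq)
    qed (use T in auto)
    also have "\<dots> \<le> 3 * p i / T\<^sup>2"
      using mom T by (simp add: edge_moments_def divide_right_mono)
    finally show ?thesis .
  qed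
  from sum_edge_blocks_const[of k n r, OF this]
  have "truncated_variance n k r P Y T \<le> (\<Sum>i=1..k. real (n choose r i) * (3 * p i / T\<^sup>2))"
    unfolding truncated_variance_def .
  also have "\<dots> = 3 * real n / T\<^sup>2 * (\<Sum>i=1..k. avg_degree n r p i / real (r i))"
    unfolding sum_distrib_left
  proof (intro sum.cong refl)
    fix i assume i: "i \<in> {1..k}"
    have "r i * (n choose r i) = n * ((n - 1) choose (r i - 1))"
      using r_range[OF i] by (intro times_binomial_minus1_eq) auto
    then have "real (r i) * real (n choose r i) = real n * real ((n - 1) choose (r i - 1))"
      by (metis of_nat_mult)
    then have "real (n choose r i) = real n * real ((n - 1) choose (r i - 1)) / real (r i)"
      using r_range[OF i] by (simp add: field_simps)
    then show "real (n choose r i) * (3 * p i / T\<^sup>2) = 3 * real n / T\<^sup>2 * (avg_degree n r p i / real (r i))"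
      by (simp add: avg_degree_def mult_ac)
  qed
  finally show ?thesis .
qed

text \<open>
  Here $n \binom{n-2}{r-2} \ge (r-1) \binom{n-1}{r-1} \ge \frac r2 \binom{n-1}{r-1}$ and
  $\sigma_i^2 \ge c\, p_i$.
\<close>
lemma variance_lower_bound:
  assumes c: "c \<ge> 0" "\<And>i. i \<in> {1..k} \<Longrightarrow> c \<le> 1 - p i"
  shows "c / 2 * (\<Sum>i=1..k. real (r i) * avg_degree n r p i) \<le> real n * S"
  unfolding sigma_sq_def sum_distrib_left
proof (rule sum_mono)
  fix i assume i: "i \<in> {1..k}"
  let ?r = "real (r i)" and ?D = "real ((n - 2) choose (r i - 2))" and ?E = "real ((n - 1) choose (r i - 1))"
  have r2: "2 \<le> ?r" using r_range[OF i] by simp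
  have "(r i - 1) * ((n - 1) choose (r i - 1)) = (n - 1) * ((n - 1 - 1) choose (r i - 1 - 1))"
    using r_range[OF i] by (intro times_binomial_minus1_eq) auto
  then have "real (r i - 1) * ?E = real (n - 1) * ?D"
    by (metis of_nat_mult diff_diff_left one_add_one)
  moreover have "?r / 2 * ?E \<le> real (r i - 1) * ?E" "real (n - 1) * ?D \<le> real n * ?D"
    using r_range[OF i] by (intro mult_right_mono; simp add: of_nat_diff)+
  ultimately have le: "?r / 2 * ?E \<le> real n * ?D" by linarith
  have "p i * c \<le> p i * (1 - p i)"
    using p_range[OF i] c(2)[OF i] by (intro mult_left_mono) auto
  from mult_mono[OF le this] have "(?r / 2 * ?E) * (p i * c) \<le> (real n * ?D) * (p i * (1 - p i))"
    using p_range[OF i] c(1) by simp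
  then show "c / 2 * (?r * avg_degree n r p i) \<le> real n * (?D * sigma_sq_i p i)"
    by (simp add: avg_degree_def sigma_sq_i_def mult_ac)
qed

text \<open>
  Write $D_1 = \sum_i r_i d_i$ and $D_2 = \sum_i d_i / r_i$. The fourth moment bound at
  $T = \epsilon K_n$ is $3 r_{\max}^{12} \xi^2 D_2 / (\epsilon^2 \sigma^2)$, so the claim amounts to
  $3 r_{\max}^{16} \xi^2 D_2 \le \delta \epsilon^2 (n \sigma^2)^2$, and $n\sigma^2 \ge \frac c2 D_1$. The constant
  $12 = 3 \cdot 4$ combines this $3$ with the square of $\frac12$.
\<close>
lemma truncated_variance_small:
  assumes Y: "edge_vector n k r p P Y" and c: "c > 0" "\<And>i. i \<in> {1..k} \<Longrightarrow> c \<le> 1 - p i"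
    and \<epsilon>: "\<epsilon> > 0" and \<delta>: "\<delta> > 0" and \<xi>: "1 \<le> R\<^sup>2 * xi k r w"
    and ratio: "12 / (\<delta> * \<epsilon>\<^sup>2 * c\<^sup>2) \<le> (\<Sum>i=1..k. real (r i) * avg_degree n r p i)\<^sup>2
                 / (R ^ 16 * (xi k r w)\<^sup>2 * (\<Sum>i=1..k. avg_degree n r p i / real (r i)))"
  shows "truncated_variance n k r P Y (\<epsilon> * K_trunc n k r p w) \<le> \<delta> * ((real n)\<^sup>2 * S / R ^ 4)"
proof -
  let ?x = "xi k r w"
  define D1 where "D1 = (\<Sum>i=1..k. real (r i) * avg_degree n r p i)"
  define D2 where "D2 = (\<Sum>i=1..k. avg_degree n r p i / real (r i))"
  define T where "T = \<epsilon> * K_trunc n k r p w"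
  have R: "R > 0" using R_ge_2 by simp
  have x: "?x > 0" using \<xi> R by (metis less_le_not_le linorder_not_le mult_le_0_iff not_one_le_zero order_trans zero_le_power2)
  have T: "T = \<epsilon> * \<tau> / (R ^ 6 * ?x)" by (simp add: T_def K_trunc_def)
  have T0: "T > 0" unfolding T using \<epsilon> \<tau>_pos R x by simp
  have d: "0 \<le> avg_degree n r p i" if "i \<in> {1..k}" for i using p_range[OF that] by (simp add: avg_degree_def)
  have D1: "0 \<le> D1" and D2: "0 \<le> D2"
    unfolding D1_def D2_def by (intro sum_nonneg mult_nonneg_nonneg divide_nonneg_nonneg d; simp)+
  have "12 * (R ^ 16 * ?x\<^sup>2 * D2) \<le> \<delta> * \<epsilon>\<^sup>2 * c\<^sup>2 * D1\<^sup>2"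
  proof (cases "D2 = 0")
    case False
    then have "0 < R ^ 16 * ?x\<^sup>2 * D2" using R x D2 by simp
    then show ?thesis using ratio \<epsilon> \<delta> c(1) unfolding D1_def[symmetric] D2_def[symmetric]
      by (simp add: divide_le_eq pos_le_divide_eq mult_ac)
  qed (use \<delta> in simp)
  also have "\<delta> * \<epsilon>\<^sup>2 * c\<^sup>2 * D1\<^sup>2 = 4 * (\<delta> * \<epsilon>\<^sup>2 * (c / 2 * D1)\<^sup>2)"
    by (simp add: power2_eq_square)
  also have "\<dots> \<le> 4 * (\<delta> * \<epsilon>\<^sup>2 * (real n * S)\<^sup>2)"
    using variance_lower_bound[OF less_imp_le[OF c(1)] c(2)] D1 c(1) \<delta> unfolding D1_def[symmetric]
    by (intro mult_left_mono power_mono) auto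
  finally have key: "3 * (R ^ 16 * ?x\<^sup>2 * D2) \<le> \<delta> * \<epsilon>\<^sup>2 * (real n * S)\<^sup>2" by linarith
  have "truncated_variance n k r P Y T \<le> 3 * real n / T\<^sup>2 * D2"
    unfolding D2_def by (rule truncated_variance_fourth_moment[OF Y T0])
  also have "T\<^sup>2 = \<epsilon>\<^sup>2 * (real n * S) / (R ^ 12 * ?x\<^sup>2)"
    unfolding T power_divide power_mult_distrib \<tau>_sq by (simp flip: power_mult)
  also have "3 * real n / (\<epsilon>\<^sup>2 * (real n * S) / (R ^ 12 * ?x\<^sup>2)) * D2
      = 3 * (R ^ 16 * ?x\<^sup>2 * D2) / (\<epsilon>\<^sup>2 * S * R ^ 4)"
  proof -
    have R16: "R ^ 16 = R ^ 12 * R ^ 4" by (simp flip: power_add)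
    have cancel: "3 * m / (\<epsilon>\<^sup>2 * (m * s) / (a * y)) * D2 = 3 * (a * b * y * D2) / (\<epsilon>\<^sup>2 * s * b)"
      if "m > 0" "s > 0" "b > 0" for a b m s y :: real
      using that \<epsilon> by (simp add: field_simps)
    show ?thesis unfolding R16 by (rule cancel) (use n_pos sigma_pos R in simp_all)
  qed
  also have "\<dots> \<le> \<delta> * \<epsilon>\<^sup>2 * (real n * S)\<^sup>2 / (\<epsilon>\<^sup>2 * S * R ^ 4)"
    using key sigma_pos by (intro divide_right_mono) auto
  also have "\<dots> = \<delta> * ((real n)\<^sup>2 * S / R ^ 4)"
    using sigma_pos \<epsilon> R by (simp add: power2_eq_square)
  finally show ?thesis unfolding T_def .
qed

end

section \<open>Passage to the limit\<close>

lemma edge_block_measurable: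
  assumes P: "prob_space P" and Y: "prob_space.indep_vars P (\<lambda>_. borel) Y {1..num_edges n r k}"
    and i: "i \<in> {1..k}" "l \<in> edge_block n r i"
  shows "Y l \<in> borel_measurable P"
proof -
  have "l \<in> {1..num_edges n r k}" using edge_block_subset[OF i(1), of n r] i(2) by blast
  then show ?thesis using Y unfolding prob_space.indep_vars_def[OF P] by blast
qed

context hypergraph begin

lemma bernoulli_edge_vector:
  assumes h: "indep_edge_vector n k r (\<lambda>i. bernoulli_law (p i)) P h"
  shows "edge_vector n k r p P (centered P h)"
proof -
  have P: "prob_space P" and ind: "prob_space.indep_vars P (\<lambda>_. borel) h {1..num_edges n r k}"
    using h by (simp_all add: indep_edge_vector_def)
  have "prob_space.indep_vars P (\<lambda>_. borel) (\<lambda>l \<omega>. h l \<omega> - (\<integral>\<omega>'. h l \<omega>' \<partial>P)) {1..num_edges n r k}"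
    by (rule prob_space.indep_vars_compose2[OF P ind]) simp
  moreover have "edge_moments (p i) P (centered P h l)" if "i \<in> {1..k}" "l \<in> edge_block n r i" for i l
    using h p_range that
    by (intro bernoulli_edge_moments[OF P] edge_block_measurable[OF P ind that]) (auto simp: indep_edge_vector_def)
  ultimately show ?thesis using P by (simp add: edge_vector_def centered_def[abs_def])
qed

lemma gaussian_edge_vector:
  assumes Z: "indep_edge_vector n k r (\<lambda>i. gaussian_law (sigma_sq_i p i)) P Z"
  shows "edge_vector n k r p P Z"
proof -
  have P: "prob_space P" and ind: "prob_space.indep_vars P (\<lambda>_. borel) Z {1..num_edges n r k}"
    using Z by (simp_all add: indep_edge_vector_def)
  have "edge_moments (p i) P (Z l)" if "i \<in> {1..k}" "l \<in> edge_block n r i" for i l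
    using Z p_range that
    by (intro gaussian_edge_moments edge_block_measurable[OF P ind that])
       (auto simp: indep_edge_vector_def sigma_sq_i_def)
  then show ?thesis using P ind by (simp add: edge_vector_def)
qed

text \<open>
  \<open>xi\<close> is an average of the numbers $1/r_i^2$, each of which is at least $1/r_{\max}^2$. A bound
  that ignores the weights is called for because they are limits: a small size whose weight tends to zero
  can dominate the corresponding average at finite $n$ and be absent from \<open>xi\<close>.
\<close>
lemma xi_lower_bound:
  assumes w: "\<And>i. i \<in> {1..k} \<Longrightarrow> 0 \<le> w i" "(\<Sum>i=1..k. w i) = 1"
  shows "1 \<le> R\<^sup>2 * xi k r w"
proof -
  have "w i \<le> R\<^sup>2 * (w i * (1 / (real (r i))\<^sup>2))" if i: "i \<in> {1..k}" for i
  proof -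
    have "real (r i) > 0" using r_range[OF i] by simp
    moreover have "(real (r i))\<^sup>2 \<le> R\<^sup>2" using r_le_max[OF i] by (intro power_mono) auto
    ultimately have "1 \<le> R\<^sup>2 / (real (r i))\<^sup>2" by simp
    then show ?thesis using mult_left_mono[OF _ w(1)[OF i], of 1 "R\<^sup>2 / (real (r i))\<^sup>2"] by (simp add: mult_ac)
  qed
  then have "(\<Sum>i=1..k. w i) \<le> R\<^sup>2 * xi k r w"
    unfolding xi_def sum_distrib_left by (intro sum_mono) auto
  then show ?thesis using w(2) by simp
qed

end

lemma limit_weights:
  fixes a :: "nat \<Rightarrow> nat \<Rightarrow> real"
  assumes a: "\<And>n i. n \<ge> N \<Longrightarrow> i \<in> {1..k} \<Longrightarrow> 0 \<le> a n i" "\<And>n. n \<ge> N \<Longrightarrow> (\<Sum>i=1..k. a n i) > 0"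
    and w: "\<And>i. i \<in> {1..k} \<Longrightarrow> (\<lambda>n. a n i / (\<Sum>j=1..k. a n j)) \<longlonglongrightarrow> w i"
  shows "\<And>i. i \<in> {1..k} \<Longrightarrow> 0 \<le> w i" "(\<Sum>i=1..k. w i) = 1"
proof -
  have ev: "\<forall>\<^sub>F n in sequentially. n \<ge> N" by (rule eventually_ge_at_top)
  show "0 \<le> w i" if i: "i \<in> {1..k}" for i
  proof (rule tendsto_lowerbound[OF w[OF i]])
    show "\<forall>\<^sub>F n in sequentially. 0 \<le> a n i / (\<Sum>j=1..k. a n j)"
      using ev by eventually_elim (use a i in \<open>auto intro!: divide_nonneg_pos\<close>)
  qed simp
  have "(\<lambda>n. \<Sum>i=1..k. a n i / (\<Sum>j=1..k. a n j)) \<longlonglongrightarrow> (\<Sum>i=1..k. w i)"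
    by (intro tendsto_sum w)
  moreover have "\<forall>\<^sub>F n in sequentially. (\<Sum>i=1..k. a n i / (\<Sum>j=1..k. a n j)) = 1"
    using ev by eventually_elim (use a(2) in \<open>auto simp flip: sum_divide_distrib simp: less_imp_neq[symmetric]\<close>)
  ultimately show "(\<Sum>i=1..k. w i) = 1"
    by (intro LIMSEQ_unique[OF _ tendsto_eventually])
qed

lemma pastur_condition_truncated_variance:
  "pastur_condition k r p w P Y \<longleftrightarrow> (\<forall>\<epsilon>>0. \<forall>\<delta>>0. \<forall>\<^sub>F n in sequentially.
     \<bar>truncated_variance n k (r n) (P n) (Y n) (\<epsilon> * K_trunc n k (r n) (p n) w)\<bar>
       \<le> \<delta> * \<bar>(real n)\<^sup>2 * sigma_sq n k (r n) (p n) / (real (r_max k (r n))) ^ 4\<bar>)"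
  unfolding pastur_condition_def truncated_variance_def smallo_def by simp

lemma truncated_variance_nonneg: "0 \<le> truncated_variance n k r P Y T"
  unfolding truncated_variance_def by (intro sum_nonneg Bochner_Integration.integral_nonneg) simp

text \<open>
  The level $\epsilon$ of the truncation serves at the same time as the constant in the little-o of the
  Pastur-type condition.
\<close>
lemma gaussianizable_of_pastur:
  assumes H: "\<And>n. n \<ge> N \<Longrightarrow> hypergraph n k (r n) (p n) (e n)"
    and X: "\<And>n. n \<ge> N \<Longrightarrow> edge_vector n k (r n) (p n) (P n) (X n)"
    and Z: "\<And>n. n \<ge> N \<Longrightarrow> edge_vector n k (r n) (p n) (P' n) (Z n)"
    and \<xi>: "\<And>n. n \<ge> N \<Longrightarrow> 1 \<le> (real (r_max k (r n)))\<^sup>2 * xi k (r n) w"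
    and pX: "pastur_condition k r p w P X" and pZ: "pastur_condition k r p w P' Z"
  shows "gaussianizable k r p e P X P' Z"
  unfolding gaussianizable_def
proof (intro allI impI)
  fix z :: complex assume z: "Im z > 0"
  let ?d = "\<lambda>n. cmod
           (stieltjes (mean_esd (P n) (\<lambda>\<omega>. H_mat n k (r n) (p n) (e n) (\<lambda>l. X n l \<omega>))) z
          - stieltjes (mean_esd (P' n) (\<lambda>\<omega>. H_mat n k (r n) (p n) (e n) (\<lambda>l. Z n l \<omega>))) z)"
  define C where "C = 4 / Im z ^ 3 + 4 / Im z ^ 4"
  have C: "C > 0" using z by (simp add: C_def add_pos_pos)
  show "?d \<longlonglongrightarrow> 0"
  proof (rule tendstoI)
    fix \<eta> :: real assume \<eta>: "\<eta> > 0"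
    \<comment> \<open>The factor 2 turns the bound into a strict inequality.\<close>
    define \<epsilon> where "\<epsilon> = \<eta> / (2 * C)"
    have \<epsilon>: "\<epsilon> > 0" using \<eta> C by (simp add: \<epsilon>_def)
    have evX: "\<forall>\<^sub>F n in sequentially.
       \<bar>truncated_variance n k (r n) (P n) (X n) (\<epsilon> * K_trunc n k (r n) (p n) w)\<bar>
       \<le> \<epsilon> * \<bar>(real n)\<^sup>2 * sigma_sq n k (r n) (p n) / (real (r_max k (r n))) ^ 4\<bar>"
      using pX \<epsilon> unfolding pastur_condition_truncated_variance by blast
    have evZ: "\<forall>\<^sub>F n in sequentially.
       \<bar>truncated_variance n k (r n) (P' n) (Z n) (\<epsilon> * K_trunc n k (r n) (p n) w)\<bar>
       \<le> \<epsilon> * \<bar>(real n)\<^sup>2 * sigma_sq n k (r n) (p n) / (real (r_max k (r n))) ^ 4\<bar>"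
      using pZ \<epsilon> unfolding pastur_condition_truncated_variance by blast
    show "\<forall>\<^sub>F n in sequentially. dist (?d n) 0 < \<eta>"
      using evX evZ eventually_ge_at_top[of N]
    proof eventually_elim
      case (elim n)
      interpret hypergraph n k "r n" "p n" "e n" by (rule H[OF elim(3)])
      have pos: "0 \<le> (real n)\<^sup>2 * sigma_sq n k (r n) (p n) / (real (r_max k (r n))) ^ 4"
        using sigma_pos by simp
      have "?d n \<le> \<epsilon> * (4 / Im z ^ 3 + 4 / Im z ^ 4)"
        by (rule stieltjes_distance[OF X[OF elim(3)] Z[OF elim(3)] z \<epsilon> \<xi>[OF elim(3)]])
           (use elim(1,2) pos in \<open>simp_all only: abs_of_nonneg truncated_variance_nonneg\<close>)
      also have "\<dots> = \<eta> / 2" using C by (simp add: \<epsilon>_def C_def[symmetric])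
      finally show ?case using \<eta> by simp
    qed
  qed
qed

lemma pastur_of_ratio:
  assumes H: "\<And>n. n \<ge> N \<Longrightarrow> hypergraph n k (r n) (p n) (e n)"
    and Y: "\<And>n. n \<ge> N \<Longrightarrow> edge_vector n k (r n) (p n) (P n) (Y n)"
    and \<xi>: "\<And>n. n \<ge> N \<Longrightarrow> 1 \<le> (real (r_max k (r n)))\<^sup>2 * xi k (r n) w"
    and c: "c > 0" "\<forall>\<^sub>F n in sequentially. \<forall>i\<in>{1..k}. c \<le> 1 - p n i"
    and ratio: "filterlim
            (\<lambda>n. (\<Sum>i=1..k. real (r n i) * avg_degree n (r n) (p n) i)^2
                 / ((real (r_max k (r n)))^16 * (xi k (r n) w)^2
                    * (\<Sum>i=1..k. avg_degree n (r n) (p n) i / real (r n i))))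
            at_top sequentially"
  shows "pastur_condition k r p w P Y"
  unfolding pastur_condition_truncated_variance
proof (intro allI impI)
  fix \<epsilon> \<delta> :: real assume \<epsilon>: "\<epsilon> > 0" and \<delta>: "\<delta> > 0"
  have "\<forall>\<^sub>F n in sequentially. 12 / (\<delta> * \<epsilon>\<^sup>2 * c\<^sup>2) \<le> (\<Sum>i=1..k. real (r n i) * avg_degree n (r n) (p n) i)^2
                 / ((real (r_max k (r n)))^16 * (xi k (r n) w)^2
                    * (\<Sum>i=1..k. avg_degree n (r n) (p n) i / real (r n i)))"
    using ratio unfolding filterlim_at_top by blast
  then show "\<forall>\<^sub>F n in sequentially.
     \<bar>truncated_variance n k (r n) (P n) (Y n) (\<epsilon> * K_trunc n k (r n) (p n) w)\<bar>
       \<le> \<delta> * \<bar>(real n)\<^sup>2 * sigma_sq n k (r n) (p n) / (real (r_max k (r n))) ^ 4\<bar>"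
    using c(2) eventually_ge_at_top[of N]
  proof eventually_elim
    case (elim n)
    interpret hypergraph n k "r n" "p n" "e n" by (rule H[OF elim(3)])
    have pos: "0 \<le> (real n)\<^sup>2 * sigma_sq n k (r n) (p n) / (real (r_max k (r n))) ^ 4"
      using sigma_pos by simp
    have "truncated_variance n k (r n) (P n) (Y n) (\<epsilon> * K_trunc n k (r n) (p n) w)
        \<le> \<delta> * ((real n)\<^sup>2 * sigma_sq n k (r n) (p n) / (real (r_max k (r n))) ^ 4)"
      by (rule truncated_variance_small[OF Y[OF elim(3)] c(1) _ \<epsilon> \<delta> \<xi>[OF elim(3)] elim(1)])
         (use elim(2) in blast)
    then show ?case
      unfolding abs_of_nonneg[OF pos] abs_of_nonneg[OF truncated_variance_nonneg] .
  qed
qed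

lemma bounded_away_from_one:
  fixes p :: "nat \<Rightarrow> nat \<Rightarrow> real"
  assumes p: "\<And>n i. n \<ge> N \<Longrightarrow> i \<in> {1..k} \<Longrightarrow> p n i \<le> 1"
    and \<Theta>: "\<forall>i\<in>{1..k}. (\<lambda>n. 1 - p n i) \<in> \<Theta>(\<lambda>_. 1)"
  shows "\<exists>c>0. \<forall>\<^sub>F n in sequentially. \<forall>i\<in>{1..k}. c \<le> 1 - p n i"
proof -
  have "\<exists>c>0. \<forall>\<^sub>F n in sequentially. c \<le> 1 - p n i" if i: "i \<in> {1..k}" for i
  proof -
    have "(\<lambda>n. 1 - p n i) \<in> \<Omega>(\<lambda>_. 1)" using \<Theta> i by blast
    then obtain c where c: "c > 0" "\<forall>\<^sub>F n in sequentially. norm (1 - p n i) \<ge> c * norm (1::real)"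
      by (elim landau_omega.bigE) blast
    have "\<forall>\<^sub>F n in sequentially. c \<le> 1 - p n i"
      using c(2) eventually_ge_at_top[of N] by eventually_elim (use p i in auto)
    then show ?thesis using c(1) by blast
  qed
  then obtain c where c: "\<And>i. i \<in> {1..k} \<Longrightarrow> c i > 0"
    "\<And>i. i \<in> {1..k} \<Longrightarrow> \<forall>\<^sub>F n in sequentially. c i \<le> 1 - p n i"
    by metis
  \<comment> \<open>The element 1 keeps the minimum defined when there are no sizes at all.\<close>
  define m where "m = Min (insert 1 (c ` {1..k}))"
  have "m > 0" unfolding m_def using c(1) by (subst Min_gr_iff) auto
  moreover have "\<forall>\<^sub>F n in sequentially. \<forall>i\<in>{1..k}. c i \<le> 1 - p n i"
    by (rule eventually_ball_finite) (use c(2) in auto)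
  then have "\<forall>\<^sub>F n in sequentially. \<forall>i\<in>{1..k}. m \<le> 1 - p n i"
  proof eventually_elim
    case (elim n)
    have "m \<le> c i" if "i \<in> {1..k}" for i unfolding m_def using that by (intro Min_le) auto
    then show ?case using elim order_trans by blast
  qed
  ultimately show ?thesis by blast
qed

theorem theorem3p10:
  fixes k n0 :: nat
    and r :: "nat \<Rightarrow> nat \<Rightarrow> nat"
    and p :: "nat \<Rightarrow> nat \<Rightarrow> real"
    and e :: "nat \<Rightarrow> nat \<Rightarrow> nat set"
    and w :: "nat \<Rightarrow> real"
    and P :: "nat \<Rightarrow> 'a measure"
    and h :: "nat \<Rightarrow> nat \<Rightarrow> 'a \<Rightarrow> real"
    and P' :: "nat \<Rightarrow> 'b measure"
    and Z :: "nat \<Rightarrow> nat \<Rightarrow> 'b \<Rightarrow> real"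
  defines "X \<equiv> \<lambda>n. centered (P n) (h n)"
  assumes r_range: "\<And>n i. n \<ge> n0 \<Longrightarrow> i \<in> {1..k} \<Longrightarrow> 2 \<le> r n i \<and> r n i \<le> n"
    and p_range: "\<And>n i. n \<ge> n0 \<Longrightarrow> i \<in> {1..k} \<Longrightarrow> 0 \<le> p n i \<and> p n i \<le> 1"
    and edges: "\<And>n. n \<ge> n0 \<Longrightarrow> edge_enumeration n k (r n) (e n)"
    and indicators: "\<And>n. n \<ge> n0 \<Longrightarrow>
          indep_edge_vector n k (r n) (\<lambda>i. bernoulli_law (p n i)) (P n) (h n)"
    and gaussians: "\<And>n. n \<ge> n0 \<Longrightarrow>
          indep_edge_vector n k (r n) (\<lambda>i. gaussian_law (sigma_sq_i (p n) i)) (P' n) (Z n)"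
    and sigma_pos: "\<And>n. n \<ge> n0 \<Longrightarrow> sigma_sq n k (r n) (p n) > 0"
    and weights: "\<And>i. i \<in> {1..k} \<Longrightarrow>
          (\<lambda>n. real ((n - 2) choose (r n i - 2)) * sigma_sq_i (p n) i
               / (\<Sum>j=1..k. real ((n - 2) choose (r n j - 2)) * sigma_sq_i (p n) j))
          \<longlonglongrightarrow> w i"
  shows "(pastur_condition k r p w P X \<and> pastur_condition k r p w P' Z
            \<longrightarrow> gaussianizable k r p e P X P' Z)
       \<and> ((\<forall>i\<in>{1..k}. (\<lambda>n. 1 - p n i) \<in> \<Theta>(\<lambda>_. 1)) \<and>
          filterlim
            (\<lambda>n. (\<Sum>i=1..k. real (r n i) * avg_degree n (r n) (p n) i)^2
                 / ((real (r_max k (r n)))^16 * (xi k (r n) w)^2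
                    * (\<Sum>i=1..k. avg_degree n (r n) (p n) i / real (r n i))))
            at_top sequentially
            \<longrightarrow> pastur_condition k r p w P X \<and> pastur_condition k r p w P' Z
               \<and> gaussianizable k r p e P X P' Z)"
proof -
  have H: "hypergraph n k (r n) (p n) (e n)" if "n \<ge> n0" for n
    using that r_range p_range edges sigma_pos by unfold_locales auto
  have X: "edge_vector n k (r n) (p n) (P n) (X n)" if "n \<ge> n0" for n
    unfolding X_def by (rule hypergraph.bernoulli_edge_vector[OF H[OF that] indicators[OF that]])
  have Z: "edge_vector n k (r n) (p n) (P' n) (Z n)" if "n \<ge> n0" for n
    by (rule hypergraph.gaussian_edge_vector[OF H[OF that] gaussians[OF that]])
  have nonneg: "0 \<le> real ((n - 2) choose (r n i - 2)) * sigma_sq_i (p n) i"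
    if "n \<ge> n0" "i \<in> {1..k}" for n i
    using hypergraph.sigma_sq_i_nonneg[OF H[OF that(1)] that(2)] by simp
  note w = limit_weights[where N = n0 and k = k and w = w
      and a = "\<lambda>n i. real ((n - 2) choose (r n i - 2)) * sigma_sq_i (p n) i",
      OF nonneg sigma_pos[unfolded sigma_sq_def] weights]
  have \<xi>: "1 \<le> (real (r_max k (r n)))\<^sup>2 * xi k (r n) w" if "n \<ge> n0" for n
    by (rule hypergraph.xi_lower_bound[OF H[OF that] w])
  have gaussian: "gaussianizable k r p e P X P' Z"
    if "pastur_condition k r p w P X" "pastur_condition k r p w P' Z"
    by (rule gaussianizable_of_pastur[where N = n0 and w = w, OF H X Z \<xi> that])
  moreover have "pastur_condition k r p w P X \<and> pastur_condition k r p w P' Z"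
    if \<Theta>: "\<forall>i\<in>{1..k}. (\<lambda>n. 1 - p n i) \<in> \<Theta>(\<lambda>_. 1)"
      and ratio: "filterlim
            (\<lambda>n. (\<Sum>i=1..k. real (r n i) * avg_degree n (r n) (p n) i)^2
                 / ((real (r_max k (r n)))^16 * (xi k (r n) w)^2
                    * (\<Sum>i=1..k. avg_degree n (r n) (p n) i / real (r n i))))
            at_top sequentially"
  proof -
    obtain c where c: "c > 0" "\<forall>\<^sub>F n in sequentially. \<forall>i\<in>{1..k}. c \<le> 1 - p n i"
      using bounded_away_from_one[OF _ \<Theta>, where N = n0] p_range by blast
    show ?thesis
      using pastur_of_ratio[OF H X \<xi> c ratio] pastur_of_ratio[OF H Z \<xi> c ratio] by blast
  qed
  ultimately show ?thesis by blast
qed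

end
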